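(* Let $v \in L^{\infty}(\mathbb{R})$ be a non-negative potential such that, for some constant $C>0$, $$|v(x)| \leq \frac{C}{|x|^2} \quad \text{for a.e. } x \in \mathbb{R}.$$ Then there exists a constant $\beta$ such that $$\Gamma_v(L) \leq \frac{\beta}{L^2}$$ for all $L$ large enough.
   Context: For a bounded non-negative potential $v:\mathbb{R}\to\mathbb{R}_{\geq 0}$ and $L>0$, let $h^D_L = -\frac{\mathrm{d}^2}{\mathrm{d}x^2}+v(x)$ be the self-adjoint Schrödinger operator on $L^2((-L/2,+L/2))$ with Dirichlet boundary conditions at $x=\pm L/2$. It has purely discrete spectrum; its eigenvalues, counted with multiplicity, are $\varepsilon_0(L) < \varepsilon_1(L) \leq \dots$. The spectral gap is $\Gamma_v(L) := \varepsilon_1(L)-\varepsilon_0(L)$. *)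

theory Defs
  imports "HOL-Analysis.Analysis" "HOL-Library.Function_Algebras"
begin

definition Linfty :: "(real \<Rightarrow> real) \<Rightarrow> bool" where
  "Linfty v \<longleftrightarrow>
     v \<in> borel_measurable lebesgue \<and> (\<exists>M. AE x in lebesgue. \<bar>v x\<bar> \<le> M)"

definition L2 :: "real \<Rightarrow> (real \<Rightarrow> complex) \<Rightarrow> bool" where
  "L2 L f \<longleftrightarrow>
     f \<in> borel_measurable (lebesgue_on {-L/2<..<L/2}) \<and>
     integrable (lebesgue_on {-L/2<..<L/2}) (\<lambda>x. (cmod (f x))\<^sup>2)"

text \<open>
  In one dimension, \<open>H\<^sup>2((-L/2, L/2))\<close> consists of the \<open>C\<^sup>1\<close> functions on the closed interval
  whose derivative \<open>p\<close> is absolutely continuous with square-integrable derivative \<open>w\<close>.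
  Absolute continuity is expressed by \<open>p\<close> being an indefinite Lebesgue integral of \<open>w\<close>.
  The predicate says that \<open>u\<close> is such a function and \<open>w\<close> is a version of \<open>u''\<close>.
\<close>

definition H2_second_deriv :: "real \<Rightarrow> (real \<Rightarrow> complex) \<Rightarrow> (real \<Rightarrow> complex) \<Rightarrow> bool" where
  "H2_second_deriv L u w \<longleftrightarrow>
     L2 L w \<and>
     (\<exists>p. \<forall>x\<in>{-L/2..L/2}.
        (u has_vector_derivative p x) (at x within {-L/2..L/2}) \<and>
        p x = p (-L/2) + integral\<^sup>L (lebesgue_on {-L/2<..<x}) w)"

text \<open>
  The operator domain \<open>H\<^sup>2 \<inter> H\<^sup>1\<^sub>0\<close>. Each \<open>L\<^sup>2\<close>-class in the domain is represented by
  its continuous version on \<open>[-L/2, L/2]\<close>, extended by 0 to the real line; this makes the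
  representative unique, so linear dimensions may be computed in the function space.
\<close>

definition dirichlet_domain :: "real \<Rightarrow> (real \<Rightarrow> complex) set" where
  "dirichlet_domain L =
     {u. (\<exists>w. H2_second_deriv L u w) \<and> u (-L/2) = 0 \<and> u (L/2) = 0 \<and>
         (\<forall>x. x \<notin> {-L/2..L/2} \<longrightarrow> u x = 0)}"

text \<open>
  The graph of \<open>-d\<^sup>2/dx\<^sup>2 + v\<close>: the function \<open>u\<close> is in the domain and is mapped to the
  \<open>L\<^sup>2\<close>-class of \<open>f\<close>.
\<close>

definition schrodinger_op ::
    "(real \<Rightarrow> real) \<Rightarrow> real \<Rightarrow> (real \<Rightarrow> complex) \<Rightarrow> (real \<Rightarrow> complex) \<Rightarrow> bool" where
  "schrodinger_op v L u f \<longleftrightarrow>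
     u \<in> dirichlet_domain L \<and> L2 L f \<and>
     (\<exists>w. H2_second_deriv L u w \<and>
        (AE x in lebesgue_on {-L/2<..<L/2}. f x = - w x + complex_of_real (v x) * u x))"

definition eigenspace :: "(real \<Rightarrow> real) \<Rightarrow> real \<Rightarrow> real \<Rightarrow> (real \<Rightarrow> complex) set" where
  "eigenspace v L \<mu> = {u. schrodinger_op v L u (\<lambda>x. complex_of_real \<mu> * u x)}"

definition fun_scale :: "complex \<Rightarrow> (real \<Rightarrow> complex) \<Rightarrow> (real \<Rightarrow> complex)" where
  "fun_scale c f = (\<lambda>x. c * f x)"

lemma vector_space_fun_scale: "vector_space fun_scale"
  by unfold_locales (auto simp: fun_scale_def fun_eq_iff algebra_simps)

text \<open>
  The library's dimension is 0 for infinite-dimensional spaces. This case does not arise, since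
  solutions of \<open>-u'' + v u = \<mu> u\<close> are determined by \<open>u\<close> and \<open>u'\<close> at one point.
\<close>

definition multiplicity_ev :: "(real \<Rightarrow> real) \<Rightarrow> real \<Rightarrow> real \<Rightarrow> nat" where
  "multiplicity_ev v L \<mu> = vector_space.dim fun_scale (eigenspace v L \<mu>)"

text \<open>
  There are at least \<open>n\<close> eigenvalues, counted with multiplicity, that are at most \<open>E\<close>.
  Points \<open>\<mu>\<close> that are not eigenvalues have multiplicity 0 and contribute nothing.
\<close>

definition at_least_eigenvalues_le :: "(real \<Rightarrow> real) \<Rightarrow> real \<Rightarrow> nat \<Rightarrow> real \<Rightarrow> bool" where
  "at_least_eigenvalues_le v L n E \<longleftrightarrow>
     (\<exists>F. finite F \<and> F \<subseteq> {..E} \<and> n \<le> (\<Sum>\<mu>\<in>F. multiplicity_ev v L \<mu>))"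

text \<open>
  The eigenvalues in increasing order, counted with multiplicity and from 0. As the spectrum is
  discrete, the infimum is a minimum.
\<close>

definition eigenvalue :: "(real \<Rightarrow> real) \<Rightarrow> real \<Rightarrow> nat \<Rightarrow> real" where
  "eigenvalue v L n = Inf {E. at_least_eigenvalues_le v L (Suc n) E}"

definition spectral_gap :: "(real \<Rightarrow> real) \<Rightarrow> real \<Rightarrow> real" where
  "spectral_gap v L = eigenvalue v L 1 - eigenvalue v L 0"

end

theory Submission imports Defs begin

text \<open>
  Since \<open>v \<ge> 0\<close>, every eigenvalue is positive, so it suffices to find two eigenvalues below
  \<open>M = \<beta> / L\<^sup>2\<close>. They come from shooting: let \<open>u\<^sub>\<mu>\<close> solve \<open>u'' = (v - \<mu>) u\<close>
  with \<open>u = 0\<close>, \<open>u' = 1\<close> at the left endpoint; \<open>\<mu>\<close> is an eigenvalue iff \<open>u\<^sub>\<mu>\<close> vanishes at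
  the right endpoint, and it is then simple. At \<open>\<mu> = 0\<close> there is no further zero. At \<open>\<mu> = M\<close>
  the decay of \<open>v\<close> makes \<open>\<mu> - v\<close> at least of order \<open>1 / L\<^sup>2\<close> away from the origin, which forces a
  zero in each of \<open>[L/8, L/4]\<close> and \<open>[3L/8, L/2]\<close>. Zeros are simple, hence persist under small
  changes of \<open>\<mu>\<close> as long as they are interior. So the least \<open>\<mu>\<close> for which there is one further zero,
  and the least \<open>\<mu>\<close> for which there are two, have their last zero at the right endpoint; they differ
  because otherwise the smaller of two zeros would persist below the first of these values.
\<close>

section \<open>The initial value problem\<close>

text \<open>Writing \<open>G\<close> for the right-hand side,
  \<open>G t * exp (- K * (t - a))\<close> has derivative
  \<open>K * (f t - G t) * exp (- K * (t - a))\<close>, which is nonpositive because f \<le> G;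
  hence it stays below its value \<open>A\<close> at \<open>a\<close>.\<close>

lemma gronwall_integral:
  fixes f :: "real \<Rightarrow> real"
  assumes cont: "continuous_on {a..b} f" and "K \<ge> 0"
    and le: "\<And>x. x \<in> {a..b} \<Longrightarrow> f x \<le> A + K * integral {a..x} f"
    and x: "x \<in> {a..b}"
  shows "f x \<le> A * exp (K * (x - a))"
proof -
  define G where "G t = A + K * integral {a..t} f" for t
  define h where "h t = G t * exp (- K * (t - a))" for t
  have "h x \<le> h a"
  proof (rule DERIV_nonpos_imp_decreasing_open[where f=h])
    fix t assume t: "a < t" "t < x"
    have "((\<lambda>s. integral {a..s} f) has_real_derivative f t) (at t within {a..b})"
      using t x by (intro integral_has_real_derivative cont) auto
    moreover have "at t within {a..b} = at t"
      using t x by (intro at_within_Icc_at) auto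
    ultimately have "(h has_real_derivative
        K * (f t - G t) * exp (- K * (t - a))) (at t)"
      unfolding h_def G_def by (auto intro!: derivative_eq_intros simp: algebra_simps)
    moreover have "K * (f t - G t) * exp (- K * (t - a)) \<le> 0"
      using le[of t] t x \<open>K \<ge> 0\<close>
      by (auto simp: G_def mult_le_0_iff zero_le_mult_iff)
    ultimately show "\<exists>y. (h has_real_derivative y) (at t) \<and> y \<le> 0" by blast
  next
    have "f integrable_on {a..x}"
      using x by (intro integrable_continuous_real continuous_on_subset[OF cont]) auto
    then show "continuous_on {a..x} h"
      unfolding h_def G_def by (intro continuous_intros indefinite_integral_continuous_1)
  qed (use x in auto)
  then have "G x * exp (- (K * (x - a))) \<le> A" by (simp add: h_def G_def)
  then have "G x \<le> A * exp (K * (x - a))"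
    by (simp add: exp_minus pos_le_divide_eq[symmetric] divide_inverse)
  then show ?thesis using le[OF x] by (simp add: G_def)
qed

text \<open>The product is dominated by \<open>K * norm (f t)\<close>. Absolute integrability is
  what later allows these gauge integrals to be exchanged for the Lebesgue integrals in the
  definition of the operator.\<close>

lemma absolutely_integrable_scaleR_continuous:
  fixes f :: "real \<Rightarrow> 'a::euclidean_space"
  assumes "q \<in> borel_measurable lebesgue" "\<And>t. \<bar>q t\<bar> \<le> K" "continuous_on {a..b} f"
  shows "(\<lambda>t. q t *\<^sub>R f t) absolutely_integrable_on {a..b}"
proof (rule measurable_bounded_by_integrable_imp_absolutely_integrable)
  have "f \<in> borel_measurable (lebesgue_on {a..b})"
    by (intro continuous_imp_measurable_on_sets_lebesgue assms) auto
  moreover have "q \<in> borel_measurable (lebesgue_on {a..b})"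
    using assms(1) by (rule measurable_restrict_space1)
  ultimately show "(\<lambda>t. q t *\<^sub>R f t) \<in> borel_measurable (lebesgue_on {a..b})"
    by (rule borel_measurable_scaleR[rotated])
  show "(\<lambda>t. K * norm (f t)) integrable_on {a..b}"
    by (intro integrable_continuous_real continuous_intros assms)
  show "norm (q t *\<^sub>R f t) \<le> K * norm (f t)" for t
    using assms(2)[of t] by (simp add: mult_right_mono)
qed auto

lemma integrable_scaleR_continuous:
  fixes f :: "real \<Rightarrow> 'a::euclidean_space"
  assumes "q \<in> borel_measurable lebesgue" "\<And>t. \<bar>q t\<bar> \<le> K" "continuous_on {a..b} f"
    and "a \<le> c" "d \<le> b"
  shows "(\<lambda>t. q t *\<^sub>R f t) integrable_on {c..d}"
proof -
  have "(\<lambda>t. q t *\<^sub>R f t) absolutely_integrable_on {c..d}"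
    using assms by (intro absolutely_integrable_scaleR_continuous[of q K])
      (auto intro: continuous_on_subset)
  then show ?thesis by (rule set_lebesgue_integral_eq_integral(1))
qed

text \<open>
  Solutions, in the integrated (Caratheodory) sense, of \<open>u' = p\<close>, \<open>p' = q u\<close>, \<open>u a = 0\<close>, \<open>p a = c\<close>, where \<open>q\<close> is
  merely measurable.
\<close>

definition ivp_solution ::
    "real \<Rightarrow> real \<Rightarrow> (real \<Rightarrow> real) \<Rightarrow> 'a \<Rightarrow> (real \<Rightarrow> 'a) \<Rightarrow> (real \<Rightarrow> 'a::euclidean_space) \<Rightarrow> bool" where
  "ivp_solution a b q c u p \<longleftrightarrow>
     continuous_on {a..b} u \<and> continuous_on {a..b} p \<and>
     (\<forall>x\<in>{a..b}. u x = integral {a..x} p \<and> p x = c + integral {a..x} (\<lambda>t. q t *\<^sub>R u t))"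

text \<open>Gronwall for the sum of the two norms. One estimate serves two ends: \<delta> = 0 gives
  uniqueness, and coefficients v - \<mu>, v - \<nu> with \<delta> = |\<mu> - \<nu>| give Lipschitz
  dependence on the parameter.\<close>

lemma ivp_solution_dist:
  fixes u1 u2 p1 p2 :: "real \<Rightarrow> 'a::euclidean_space"
  assumes s1: "ivp_solution a b q1 c1 u1 p1" and s2: "ivp_solution a b q2 c2 u2 p2"
    and q1: "q1 \<in> borel_measurable lebesgue" "\<And>t. \<bar>q1 t\<bar> \<le> K"
    and q2: "q2 \<in> borel_measurable lebesgue" "\<And>t. \<bar>q2 t\<bar> \<le> K"
    and \<delta>: "\<And>t. \<bar>q1 t - q2 t\<bar> \<le> \<delta>"
    and B: "\<And>x. x \<in> {a..b} \<Longrightarrow> norm (u2 x) \<le> B"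
    and x: "x \<in> {a..b}"
  shows "norm (u1 x - u2 x) + norm (p1 x - p2 x)
    \<le> (norm (c1 - c2) + \<delta> * B * (b - a)) * exp ((K + 1) * (x - a))"
proof -
  define d where "d t = u1 t - u2 t" for t
  define e where "e t = p1 t - p2 t" for t
  define f where "f t = norm (d t) + norm (e t)" for t
  have cont: "continuous_on {a..b} d" "continuous_on {a..b} e"
      "continuous_on {a..b} u1" "continuous_on {a..b} u2"
      "continuous_on {a..b} p1" "continuous_on {a..b} p2"
    using s1 s2 unfolding ivp_solution_def d_def e_def by (auto intro!: continuous_intros)
  then have f: "continuous_on {a..b} f"
    unfolding f_def by (intro continuous_intros)
  have "K \<ge> 0" using q1(2)[of a] by linarith
  have "\<delta> \<ge> 0" using \<delta>[of a] by linarith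
  have "B \<ge> 0" using order_trans[OF norm_ge_zero B[OF x]] .
  have "f x \<le> (norm (c1 - c2) + \<delta> * B * (b - a)) * exp ((K + 1) * (x - a))"
  proof (rule gronwall_integral[OF f _ _ x])
    fix x assume x: "x \<in> {a..b}"
    have sub: "{a..x} \<subseteq> {a..b}" using x by auto
    have ix: "g integrable_on {a..x}" if "continuous_on {a..b} g" for g :: "real \<Rightarrow> 'b::euclidean_space"
      using continuous_on_subset[OF that sub] by (rule integrable_continuous_real)
    have "d x = integral {a..x} e"
      using s1 s2 x cont unfolding ivp_solution_def d_def e_def
      by (simp add: Henstock_Kurzweil_Integration.integral_diff ix)
    then have "norm (d x) \<le> integral {a..x} (\<lambda>t. norm (e t))"
      using cont by (auto intro!: Henstock_Kurzweil_Integration.integral_norm_bound_integral ix continuous_intros)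
    have i1: "(\<lambda>t. q1 t *\<^sub>R u1 t) integrable_on {a..x}"
      by (rule integrable_scaleR_continuous[OF q1 cont(3)]) (use x in auto)
    have i2: "(\<lambda>t. q2 t *\<^sub>R u2 t) integrable_on {a..x}"
      by (rule integrable_scaleR_continuous[OF q2 cont(4)]) (use x in auto)
    have "e x = (c1 - c2) + integral {a..x} (\<lambda>t. q1 t *\<^sub>R u1 t - q2 t *\<^sub>R u2 t)"
      using s1 s2 x unfolding ivp_solution_def e_def
      by (simp add: Henstock_Kurzweil_Integration.integral_diff i1 i2)
    then have "norm (e x) \<le> norm (c1 - c2) + norm (integral {a..x} (\<lambda>t. q1 t *\<^sub>R u1 t - q2 t *\<^sub>R u2 t))"
      by (simp add: norm_triangle_ineq)
    also have "norm (integral {a..x} (\<lambda>t. q1 t *\<^sub>R u1 t - q2 t *\<^sub>R u2 t))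
        \<le> integral {a..x} (\<lambda>t. K * norm (d t) + \<delta> * B)"
    proof (rule Henstock_Kurzweil_Integration.integral_norm_bound_integral)
      fix t assume t: "t \<in> {a..x}"
      \<comment> \<open>This splitting pairs the difference of the coefficients with
        \<open>u2\<close> alone, so an a priori bound is required of only one of the two
        solutions.\<close>
      have "q1 t *\<^sub>R u1 t - q2 t *\<^sub>R u2 t = q1 t *\<^sub>R d t + (q1 t - q2 t) *\<^sub>R u2 t"
        by (simp add: d_def algebra_simps)
      then have "norm (q1 t *\<^sub>R u1 t - q2 t *\<^sub>R u2 t) \<le> \<bar>q1 t\<bar> * norm (d t) + \<bar>q1 t - q2 t\<bar> * norm (u2 t)"
        by (metis norm_scaleR norm_triangle_ineq)
      also have "\<dots> \<le> K * norm (d t) + \<delta> * B"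
        using q1(2)[of t] \<delta>[of t] B[of t] t x \<open>\<delta> \<ge> 0\<close> by (intro add_mono mult_mono) auto
      finally show "norm (q1 t *\<^sub>R u1 t - q2 t *\<^sub>R u2 t) \<le> K * norm (d t) + \<delta> * B" .
    qed (use cont in \<open>auto intro!: integrable_diff i1 i2 ix[of "\<lambda>t. K * norm (d t) + \<delta> * B"] continuous_intros\<close>)
    also have "\<dots> = K * integral {a..x} (\<lambda>t. norm (d t)) + \<delta> * B * (x - a)"
      using cont x by (subst Henstock_Kurzweil_Integration.integral_add) (auto intro!: ix continuous_intros)
    finally have "norm (e x) \<le> norm (c1 - c2) + (K * integral {a..x} (\<lambda>t. norm (d t)) + \<delta> * B * (b - a))"
      using x \<open>\<delta> \<ge> 0\<close> \<open>B \<ge> 0\<close> mult_left_mono[of "x-a" "b-a" "\<delta>*B"] by auto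
    moreover note \<open>norm (d x) \<le> _\<close>
    moreover have "integral {a..x} f = integral {a..x} (\<lambda>t. norm (d t)) + integral {a..x} (\<lambda>t. norm (e t))"
      unfolding f_def using cont by (intro Henstock_Kurzweil_Integration.integral_add ix continuous_intros)
    \<comment> \<open>Adding the nonnegative integral of \<open>norm (d t)\<close> and
      \<open>K\<close> times that of \<open>norm (e t)\<close> completes the two separate bounds to
      \<open>K + 1\<close> times the integral of \<open>f\<close>.\<close>
    moreover have "integral {a..x} (\<lambda>t. norm (d t)) \<ge> 0" "integral {a..x} (\<lambda>t. norm (e t)) \<ge> 0"
      by (auto intro!: Henstock_Kurzweil_Integration.integral_nonneg ix continuous_intros cont)
    moreover have "K * integral {a..x} (\<lambda>t. norm (e t)) \<ge> 0"
      using \<open>K \<ge> 0\<close> calculation by auto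
    ultimately show "f x \<le> norm (c1 - c2) + \<delta> * B * (b - a) + (K + 1) * integral {a..x} f"
      using f_def[of x]
        distrib_left[of "K + 1" "integral {a..x} (\<lambda>t. norm (d t))" "integral {a..x} (\<lambda>t. norm (e t))"]
      by (simp only: distrib_right mult_1)
  qed (use \<open>K \<ge> 0\<close> in auto)
  then show ?thesis by (simp add: f_def d_def e_def)
qed

lemma ivp_solution_unique:
  fixes u1 u2 p1 p2 :: "real \<Rightarrow> 'a::euclidean_space"
  assumes s1: "ivp_solution a b q c u1 p1" and s2: "ivp_solution a b q c u2 p2"
    and q: "q \<in> borel_measurable lebesgue" "\<And>t. \<bar>q t\<bar> \<le> K"
    and x: "x \<in> {a..b}"
  shows "u1 x = u2 x" "p1 x = p2 x"
proof -
  have "continuous_on {a..b} u2" using s2 by (simp add: ivp_solution_def)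
  then have "bounded (u2 ` {a..b})"
    by (intro compact_imp_bounded compact_continuous_image) auto
  then obtain B where B: "\<And>x. x \<in> {a..b} \<Longrightarrow> norm (u2 x) \<le> B"
    by (metis bounded_iff imageI)
  have "norm (u1 x - u2 x) + norm (p1 x - p2 x) \<le> 0"
    using ivp_solution_dist[OF s1 s2 q q _ B x, of 0] by simp
  then show "u1 x = u2 x" "p1 x = p2 x"
    by (smt (verit) norm_ge_zero norm_eq_zero eq_iff_diff_eq_0)+
qed

text \<open>Integrating twice turns the system into a Volterra equation. Its Picard series converges
  uniformly on the whole interval, however large \<open>K * (b - a)\<close> is, because the terms
  carry a factor 1/n!.\<close>

lemma ivp_solution_exists:
  fixes q :: "real \<Rightarrow> real"
  assumes q: "q \<in> borel_measurable lebesgue" "\<And>t. \<bar>q t\<bar> \<le> K" and "a \<le> b"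
  shows "\<exists>u p. ivp_solution a b q (1::real) u p"
proof -
  have "K \<ge> 0" using q(2)[of a] by linarith
  \<comment> \<open>Picard series for \<open>u = (x - a) + T u\<close>\<close>
  define T where "T f x = integral {a..x} (\<lambda>s. integral {a..s} (\<lambda>t. q t * f t))" for f x
  have qint: "(\<lambda>t. q t * f t) integrable_on {a..x}"
    if "continuous_on {a..b} f" "x \<in> {a..b}" for f x
    using integrable_scaleR_continuous[OF q that(1), of a x] that(2) by simp
  have qcont: "continuous_on {a..b} (\<lambda>s. integral {a..s} (\<lambda>t. q t * f t))"
    if "continuous_on {a..b} f" for f
    using that \<open>a \<le> b\<close> by (intro indefinite_integral_continuous_1 qint) auto
  have int: "g integrable_on {a..x}" if "continuous_on {a..b} g" "x \<in> {a..b}" for g :: "real \<Rightarrow> real" and x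
    using that by (intro integrable_continuous_real continuous_on_subset[OF that(1)]) auto
  have Tcont: "continuous_on {a..b} (T f)" if "continuous_on {a..b} f" for f
    unfolding T_def using \<open>a \<le> b\<close> by (intro indefinite_integral_continuous_1 int qcont that) auto
  have Tadd: "T (\<lambda>t. f t + g t) x = T f x + T g x"
    if "continuous_on {a..b} f" "continuous_on {a..b} g" "x \<in> {a..b}" for f g x
  proof -
    have "T (\<lambda>t. f t + g t) x = integral {a..x} (\<lambda>s. integral {a..s} (\<lambda>t. q t * f t) + integral {a..s} (\<lambda>t. q t * g t))"
      unfolding T_def using that
      by (intro Henstock_Kurzweil_Integration.integral_cong)
        (auto simp: distrib_left intro!: Henstock_Kurzweil_Integration.integral_add qint)
    then show ?thesis unfolding T_def using that
      by (auto intro!: Henstock_Kurzweil_Integration.integral_add int qcont)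
  qed
  \<comment> \<open>\<open>g s\<close> dominates |f| at all points up to \<open>s\<close>, so the
    inner integral is at most \<open>K * (b - a) * g s\<close>. Only the outer integration is kept
    exact; iterating it produces the factorial in \<open>\<phi>b\<close>.\<close>
  have Tbound: "\<bar>T f x\<bar> \<le> K * (b - a) * integral {a..x} g"
    if f: "continuous_on {a..b} f" and g: "continuous_on {a..b} g" and x: "x \<in> {a..b}"
      and le: "\<And>s t. a \<le> t \<Longrightarrow> t \<le> s \<Longrightarrow> s \<le> b \<Longrightarrow> \<bar>f t\<bar> \<le> g s" for f g x
  proof -
    have "norm (T f x) \<le> integral {a..x} (\<lambda>s. K * (b - a) * g s)"
      unfolding T_def
    proof (rule Henstock_Kurzweil_Integration.integral_norm_bound_integral)
      fix s assume s: "s \<in> {a..x}"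
      have "norm (integral {a..s} (\<lambda>t. q t * f t)) \<le> integral {a..s} (\<lambda>t. K * g s)"
      proof (rule Henstock_Kurzweil_Integration.integral_norm_bound_integral)
        fix t assume "t \<in> {a..s}"
        then show "norm (q t * f t) \<le> K * g s"
          unfolding norm_mult using q(2)[of t] le[of t s] s x \<open>K \<ge> 0\<close> by (intro mult_mono) auto
      qed (use s x f in \<open>auto intro!: qint\<close>)
      also have "\<dots> = K * (s - a) * g s" using s by simp
      also have "\<dots> \<le> K * (b - a) * g s"
        using s x \<open>K \<ge> 0\<close> le[of s s] by (intro mult_mono) (auto intro: order_trans[OF abs_ge_zero])
      finally show "norm (integral {a..s} (\<lambda>t. q t * f t)) \<le> K * (b - a) * g s" .
    qed (use x f g in \<open>auto intro!: int qcont continuous_intros\<close>)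
    then show ?thesis by simp
  qed
  define \<phi> where "\<phi> n = (T ^^ n) (\<lambda>x. x - a)" for n
  have \<phi>S: "\<phi> (Suc n) = T (\<phi> n)" for n by (simp add: \<phi>_def)
  have \<phi>c: "continuous_on {a..b} (\<phi> n)" for n
  proof (induction n)
    case 0 show ?case unfolding \<phi>_def by (auto intro!: continuous_intros)
  qed (simp add: \<phi>S Tcont)
  define M where "M = K * (b - a)"
  have "M \<ge> 0" using \<open>K \<ge> 0\<close> \<open>a \<le> b\<close> by (simp add: M_def)
  have \<phi>b: "\<bar>\<phi> n x\<bar> \<le> (b - a) * (M ^ n * (x - a) ^ n / fact n)" if "x \<in> {a..b}" for n x
    using that
  proof (induction n arbitrary: x)
    case 0 then show ?case by (simp add: \<phi>_def)
  next
    case (Suc n)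
    have "\<bar>T (\<phi> n) x\<bar> \<le> K * (b - a) * integral {a..x} (\<lambda>s. (b - a) * (M ^ n * (s - a) ^ n / fact n))"
    proof (rule Tbound)
      fix s t assume *: "a \<le> t" "t \<le> s" "s \<le> b"
      then have "\<bar>\<phi> n t\<bar> \<le> (b - a) * (M ^ n * (t - a) ^ n / fact n)" by (intro Suc.IH) auto
      also have "\<dots> \<le> (b - a) * (M ^ n * (s - a) ^ n / fact n)"
        using * \<open>M \<ge> 0\<close> by (intro mult_left_mono divide_right_mono power_mono) auto
      finally show "\<bar>\<phi> n t\<bar> \<le> (b - a) * (M ^ n * (s - a) ^ n / fact n)" .
    qed (use Suc.prems \<phi>c in \<open>auto intro!: continuous_intros\<close>)
    also have "((\<lambda>s. (s - a) ^ n) has_integral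
        (x - a) ^ Suc n / Suc n - (a - a) ^ Suc n / Suc n) {a..x}"
      using Suc.prems
      by (intro fundamental_theorem_of_calculus)
        (auto simp: has_real_derivative_iff_has_vector_derivative[symmetric] simp del: of_nat_Suc power_Suc intro!: derivative_eq_intros)
    then have "integral {a..x} (\<lambda>s. (s - a) ^ n) = (x - a) ^ Suc n / Suc n"
      by (simp add: integral_unique)
    then have "integral {a..x} (\<lambda>s. (b - a) * (M ^ n * (s - a) ^ n / fact n)) =
        (b - a) * (M ^ n * (x - a) ^ Suc n / fact (Suc n))"
      using integral_mult_right[of "{a..x}" "(b - a) * (M ^ n / fact n)" "\<lambda>s. (s - a) ^ n"]
      by (simp add: mult_ac)
    finally show ?case by (simp add: \<phi>S M_def mult_ac)
  qed
  define W where "W n = (b - a) * ((M * (b - a)) ^ n / fact n)" for n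
  have W: "summable W"
    unfolding W_def using summable_exp[of "M * (b - a)"] by (intro summable_mult) (simp add: field_simps)
  have \<phi>W: "norm (\<phi> n x) \<le> W n" if "x \<in> {a..b}" for n x
  proof -
    have "\<bar>\<phi> n x\<bar> \<le> (b - a) * (M ^ n * (x - a) ^ n / fact n)" by (rule \<phi>b[OF that])
    also have "\<dots> \<le> (b - a) * (M ^ n * (b - a) ^ n / fact n)"
      using that \<open>M \<ge> 0\<close> by (intro mult_left_mono divide_right_mono power_mono) auto
    finally show ?thesis by (simp add: W_def power_mult_distrib)
  qed
  define u where "u x = (\<Sum>n. \<phi> n x)" for x
  define S where "S n x = (\<Sum>i<n. \<phi> i x)" for n x
  have ul: "uniform_limit {a..b} S u sequentially"
    unfolding S_def u_def by (rule Weierstrass_m_test[OF \<phi>W W])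
  have Sc: "continuous_on {a..b} (S n)" for n
    unfolding S_def by (intro continuous_intros \<phi>c)
  have uc: "continuous_on {a..b} u"
    using uniform_limit_theorem[OF _ ul] Sc by auto
  have TS: "S (Suc n) x = (x - a) + T (S n) x" if "x \<in> {a..b}" for n x
  proof (induction n)
    case 0 show ?case by (simp add: S_def T_def \<phi>_def)
  next
    case (Suc n)
    have "S (Suc n) = (\<lambda>t. S n t + \<phi> n t)" by (auto simp: S_def)
    then have "T (S (Suc n)) x = T (S n) x + \<phi> (Suc n) x"
      using Tadd[OF Sc \<phi>c that] by (simp add: \<phi>S)
    moreover have "S (Suc (Suc n)) x = S (Suc n) x + \<phi> (Suc n) x" by (simp add: S_def)
    ultimately show ?case using Suc by simp
  qed
  have uT: "u x = (x - a) + T u x" if x: "x \<in> {a..b}" for x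
  proof -
    have "(\<lambda>n. T (S n) x) \<longlonglongrightarrow> T u x"
    proof (rule LIMSEQ_I)
      fix e :: real assume "e > 0"
      \<comment> \<open>\<open>T\<close> is Lipschitz for the supremum norm with constant
        \<open>M * (b - a)\<close>, so it commutes with the uniform limit. The added 1 keeps the
        denominator positive when that constant is zero.\<close>
      define e' where "e' = e / (M * (b - a) + 1)"
      have pos: "M * (b - a) + 1 > 0" using \<open>M \<ge> 0\<close> \<open>a \<le> b\<close> by (simp add: add_nonneg_pos)
      then have "e' > 0" using \<open>e > 0\<close> by (simp add: e'_def)
      then obtain N where N: "\<And>n t. n \<ge> N \<Longrightarrow> t \<in> {a..b} \<Longrightarrow> \<bar>S n t - u t\<bar> < e'"
        using ul unfolding uniform_limit_iff eventually_sequentially dist_real_def by metis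
      have "norm (T (S n) x - T u x) < e" if "n \<ge> N" for n
      proof -
        have "T (S n) x = T (\<lambda>t. u t + (S n t - u t)) x" by simp
        also have "\<dots> = T u x + T (\<lambda>t. S n t - u t) x"
          by (intro Tadd continuous_intros uc Sc x)
        finally have "\<bar>T (S n) x - T u x\<bar> = \<bar>T (\<lambda>t. S n t - u t) x\<bar>" by simp
        also have "\<dots> \<le> K * (b - a) * integral {a..x} (\<lambda>_. e')"
          using N[OF that] by (intro Tbound continuous_intros uc Sc x) (auto intro: less_imp_le)
        also have "\<dots> = M * (x - a) * e'" using x by (simp add: M_def)
        also have "\<dots> \<le> M * (b - a) * e'"
          using x \<open>M \<ge> 0\<close> \<open>e' > 0\<close> by (intro mult_right_mono mult_left_mono) auto
        also have "\<dots> < (M * (b - a) + 1) * e'" using \<open>e' > 0\<close> by simp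
        also have "\<dots> = e" using pos by (simp add: e'_def)
        finally show ?thesis by simp
      qed
      then show "\<exists>no. \<forall>n\<ge>no. norm (T (S n) x - T u x) < e" by blast
    qed
    then have "(\<lambda>n. (x - a) + T (S n) x) \<longlonglongrightarrow> (x - a) + T u x" by (intro tendsto_intros)
    moreover have "(\<lambda>n. S (Suc n) x) \<longlonglongrightarrow> u x"
      using tendsto_uniform_limitI[OF ul x] by (rule LIMSEQ_Suc)
    ultimately show ?thesis using TS[OF x] by (auto intro: LIMSEQ_unique)
  qed
  define p where "p x = 1 + integral {a..x} (\<lambda>t. q t * u t)" for x
  have pc: "continuous_on {a..b} p" unfolding p_def by (intro continuous_intros qcont uc)
  have "u x = integral {a..x} p" if x: "x \<in> {a..b}" for x
  proof -
    have "integral {a..x} p = integral {a..x} (\<lambda>_. 1) + T u x"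
      unfolding p_def T_def using x
      by (intro Henstock_Kurzweil_Integration.integral_add int qcont uc continuous_intros) auto
    then show ?thesis using uT[OF x] x by simp
  qed
  then have "ivp_solution a b q 1 u p"
    unfolding ivp_solution_def using uc pc by (auto simp: p_def)
  then show ?thesis by blast
qed

section \<open>Zeros moving with the parameter\<close>

text \<open>A nonzero slope gives points arbitrarily near \<open>x\<close> with values of opposite
  sign. Both signs survive a small change of the parameter, and the intermediate value theorem gives
  a zero between the points.\<close>

lemma simple_zero_persists:
  fixes U P :: "real \<Rightarrow> real \<Rightarrow> real"
  assumes cont: "continuous_on (I \<times> {a..b}) (\<lambda>(\<mu>, x). U \<mu> x)"
    and deriv: "\<And>x. x \<in> {a..b} \<Longrightarrow> (U \<mu> has_real_derivative P \<mu> x) (at x within {a..b})"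
    and \<mu>: "\<mu> \<in> I" and x: "a < x" "x < b" and zero: "U \<mu> x = 0" "P \<mu> x \<noteq> 0" and "\<epsilon> > 0"
  shows "\<exists>\<eta>>0. \<forall>\<nu>\<in>I. \<bar>\<nu> - \<mu>\<bar> < \<eta> \<longrightarrow> (\<exists>y. \<bar>y - x\<bar> < \<epsilon> \<and> a < y \<and> y < b \<and> U \<nu> y = 0)"
proof -
  have D: "(U \<mu> has_real_derivative P \<mu> x) (at x)"
    using deriv[of x] x by (simp add: at_within_Icc_at)
  define r where "r = Min {\<epsilon>, x - a, b - x}"
  have r: "r > 0" "r \<le> \<epsilon>" "r \<le> x - a" "r \<le> b - x"
    using x \<open>\<epsilon> > 0\<close> by (auto simp: r_def)
  obtain y1 y2 where y: "\<bar>y1 - x\<bar> < r" "\<bar>y2 - x\<bar> < r" "U \<mu> y1 < 0" "U \<mu> y2 > 0"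
  proof (cases "P \<mu> x > 0")
    case True
    obtain d1 where "d1 > 0" and d1: "\<And>h. h > 0 \<Longrightarrow> h < d1 \<Longrightarrow> U \<mu> x < U \<mu> (x + h)"
      using DERIV_pos_inc_right[OF D True] by blast
    obtain d2 where "d2 > 0" and d2: "\<And>h. h > 0 \<Longrightarrow> h < d2 \<Longrightarrow> U \<mu> (x - h) < U \<mu> x"
      using DERIV_pos_inc_left[OF D True] by blast
    define h where "h = Min {d1, d2, r} / 2"
    have "Min {d1, d2, r} > 0" using r \<open>d1 > 0\<close> \<open>d2 > 0\<close> by auto
    then have "h > 0" "h < d1" "h < d2" "h < r" by (auto simp: h_def)
    then show ?thesis using that[of "x - h" "x + h"] d1[of h] d2[of h] zero by auto
  next
    case False
    then have neg: "P \<mu> x < 0" using zero by auto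
    obtain d1 where "d1 > 0" and d1: "\<And>h. h > 0 \<Longrightarrow> h < d1 \<Longrightarrow> U \<mu> x > U \<mu> (x + h)"
      using DERIV_neg_dec_right[OF D neg] by blast
    obtain d2 where "d2 > 0" and d2: "\<And>h. h > 0 \<Longrightarrow> h < d2 \<Longrightarrow> U \<mu> (x - h) > U \<mu> x"
      using DERIV_neg_dec_left[OF D neg] by blast
    define h where "h = Min {d1, d2, r} / 2"
    have "Min {d1, d2, r} > 0" using r \<open>d1 > 0\<close> \<open>d2 > 0\<close> by auto
    then have "h > 0" "h < d1" "h < d2" "h < r" by (auto simp: h_def)
    then show ?thesis using that[of "x + h" "x - h"] d1[of h] d2[of h] zero by auto
  qed
  have y_in: "y1 \<in> {a..b}" "y2 \<in> {a..b}" using y r by auto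
  have cont\<mu>: "continuous_on I (\<lambda>\<nu>. U \<nu> y)" if "y \<in> {a..b}" for y
  proof -
    have "continuous_on I ((\<lambda>(\<mu>, x). U \<mu> x) \<circ> (\<lambda>\<nu>. (\<nu>, y)))"
      using that by (intro continuous_on_compose continuous_intros continuous_on_subset[OF cont]) auto
    then show ?thesis by (simp add: o_def)
  qed
  obtain \<eta>1 where \<eta>1: "\<eta>1 > 0" "\<And>\<nu>. \<nu> \<in> I \<Longrightarrow> \<bar>\<nu> - \<mu>\<bar> < \<eta>1 \<Longrightarrow> \<bar>U \<nu> y1 - U \<mu> y1\<bar> < - U \<mu> y1"
    using cont\<mu>[OF y_in(1)] \<mu> y(3) unfolding continuous_on_iff dist_real_def by (metis neg_0_less_iff_less)
  obtain \<eta>2 where \<eta>2: "\<eta>2 > 0" "\<And>\<nu>. \<nu> \<in> I \<Longrightarrow> \<bar>\<nu> - \<mu>\<bar> < \<eta>2 \<Longrightarrow> \<bar>U \<nu> y2 - U \<mu> y2\<bar> < U \<mu> y2"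
    using cont\<mu>[OF y_in(2)] \<mu> y(4) unfolding continuous_on_iff dist_real_def by metis
  have "\<exists>y. \<bar>y - x\<bar> < \<epsilon> \<and> a < y \<and> y < b \<and> U \<nu> y = 0" if \<nu>: "\<nu> \<in> I" "\<bar>\<nu> - \<mu>\<bar> < min \<eta>1 \<eta>2" for \<nu>
  proof -
    have sgn: "U \<nu> y1 < 0" "U \<nu> y2 > 0" using \<eta>1(2)[of \<nu>] \<eta>2(2)[of \<nu>] \<nu> by auto
    \<comment> \<open>The order of \<open>y1\<close> and \<open>y2\<close> depends on the sign of
      the slope, hence a segment instead of an interval. It lies in the open
      \<open>r\<close>-neighbourhood of \<open>x\<close>, which keeps the new zero strictly between
      \<open>a\<close> and \<open>b\<close>.\<close>
    have sub: "closed_segment y1 y2 \<subseteq> {x - r <..< x + r}"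
      using y by (auto simp: closed_segment_eq_real_ivl split: if_splits)
    have "continuous_on (closed_segment y1 y2) ((\<lambda>(\<mu>, x). U \<mu> x) \<circ> (\<lambda>y. (\<nu>, y)))"
      using sub \<nu> r by (intro continuous_on_compose continuous_intros continuous_on_subset[OF cont]) fastforce
    then have "connected (U \<nu> ` closed_segment y1 y2)"
      by (intro connected_continuous_image) (auto simp: o_def)
    then have "0 \<in> U \<nu> ` closed_segment y1 y2"
      by (rule connectedD_interval[where x="U \<nu> y1" and y="U \<nu> y2"]) (use sgn in auto)
    then obtain y where "y \<in> closed_segment y1 y2" "U \<nu> y = 0" by auto
    then show ?thesis using sub r by (intro exI[of _ y]) (auto simp: abs_less_iff)
  qed
  then show ?thesis using \<eta>1(1) \<eta>2(1) by (intro exI[of _ "min \<eta>1 \<eta>2"]) auto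
qed

text \<open>Each of the two least parameters is the minimum of the first coordinate over a compact
  set of zeros. A separation \<delta> of zeros, uniform in the parameter, gives this compactness: it
  stops zeros from sinking into \<open>a\<close> or merging in a limit.\<close>

lemma two_parameters_vanishing_at_endpoint:
  fixes U P :: "real \<Rightarrow> real \<Rightarrow> real"
  assumes "a < b" "0 < M"
    and contU: "continuous_on ({0..M} \<times> {a..b}) (\<lambda>(\<mu>, x). U \<mu> x)"
    and contP: "continuous_on ({0..M} \<times> {a..b}) (\<lambda>(\<mu>, x). P \<mu> x)"
    and deriv: "\<And>\<mu> x. \<mu> \<in> {0..M} \<Longrightarrow> x \<in> {a..b} \<Longrightarrow> (U \<mu> has_real_derivative P \<mu> x) (at x within {a..b})"
    and left: "\<And>\<mu>. \<mu> \<in> {0..M} \<Longrightarrow> U \<mu> a = 0"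
    and simple: "\<And>\<mu> x. \<mu> \<in> {0..M} \<Longrightarrow> x \<in> {a..b} \<Longrightarrow> U \<mu> x = 0 \<Longrightarrow> P \<mu> x \<noteq> 0"
    and none: "\<And>x. x \<in> {a<..b} \<Longrightarrow> U 0 x \<noteq> 0"
    and two: "a < c" "c < d" "d \<le> b" "U M c = 0" "U M d = 0"
  shows "\<exists>\<mu>1\<in>{0..M}. \<exists>\<mu>2\<in>{0..M}. \<mu>1 \<noteq> \<mu>2 \<and> U \<mu>1 b = 0 \<and> U \<mu>2 b = 0"
proof -
  define S where "S = {0..M} \<times> {a..b}"
  define V where "V = (\<lambda>(\<mu>, x). U \<mu> x)"
  define Q where "Q = (\<lambda>(\<mu>, x). P \<mu> x)"
  have S: "compact S" unfolding S_def by (intro compact_Times compact_Icc)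
  have V: "continuous_on S V" and Q: "continuous_on S Q" using contU contP by (simp_all add: S_def V_def Q_def)
  \<comment> \<open>Stated for a general space because it serves both the pairs in \<open>S\<close>
    and the triples in \<open>S2\<close>.\<close>
  have closed_zeros: "closed {z \<in> S'. f z = 0}" if "compact S'" "continuous_on S' f"
    for S' :: "'b::t2_space set" and f :: "'b \<Rightarrow> real"
    using continuous_closed_preimage_constant[OF that(2) compact_imp_closed[OF that(1)], of 0] by simp
  have Z: "compact {z \<in> S. V z = 0}"
    using compact_Int_closed[OF S closed_zeros[OF S V]] by (simp add: Int_def)
  \<comment> \<open>Since the compact zero set is nonempty, \<open>\<bar>Q z\<bar>\<close> attains a
    minimum on it, and this minimum is positive because all zeros are simple.\<close>
  have "(0, a) \<in> {z \<in> S. V z = 0}" using left[of 0] \<open>0 < M\<close> \<open>a < b\<close> by (simp add: S_def V_def)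
  moreover have "continuous_on {z \<in> S. V z = 0} (\<lambda>z. \<bar>Q z\<bar>)"
    by (intro continuous_intros continuous_on_subset[OF Q]) auto
  ultimately obtain z0 where z0: "z0 \<in> S" "V z0 = 0" "\<And>z. z \<in> S \<Longrightarrow> V z = 0 \<Longrightarrow> \<bar>Q z0\<bar> \<le> \<bar>Q z\<bar>"
    using continuous_attains_inf[OF Z, of "\<lambda>z. \<bar>Q z\<bar>"] by blast
  have "\<bar>Q z0\<bar> > 0" using z0(1,2) simple[of "fst z0" "snd z0"] by (auto simp: S_def V_def Q_def split: prod.splits)
  then obtain \<delta> where "\<delta> > 0" and \<delta>: "\<And>z z'. z \<in> S \<Longrightarrow> z' \<in> S \<Longrightarrow> dist z' z < \<delta> \<Longrightarrow> \<bar>Q z' - Q z\<bar> < \<bar>Q z0\<bar>"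
    using compact_uniformly_continuous[OF Q S] unfolding uniformly_continuous_on_def dist_real_def by metis
  \<comment> \<open>By Rolle, two zeros close to each other would force \<open>U\<close> and \<open>P\<close> to be small simultaneously.\<close>
  have sep: "x + \<delta> \<le> y"
    if \<mu>: "\<mu> \<in> {0..M}" and xy: "a \<le> x" "x < y" "y \<le> b" and zero: "U \<mu> x = 0" "U \<mu> y = 0" for \<mu> x y
  proof (rule ccontr)
    assume "\<not> x + \<delta> \<le> y"
    have D: "(U \<mu> has_real_derivative P \<mu> t) (at t)" if "x < t" "t < y" for t
      using deriv[OF \<mu>, of t] that xy by (simp add: at_within_Icc_at)
    have "continuous_on {a..b} (U \<mu>)"
      using deriv[OF \<mu>] by (intro DERIV_continuous_on) auto
    then have "continuous_on {x..y} (U \<mu>)"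
      by (rule continuous_on_subset) (use xy in auto)
    then obtain \<xi> where \<xi>: "x < \<xi>" "\<xi> < y" "(U \<mu> has_real_derivative 0) (at \<xi>)"
      using Rolle[of x y "U \<mu>"] xy zero D real_differentiable_def by metis
    then have "P \<mu> \<xi> = 0" using D DERIV_unique by blast
    moreover have "dist (\<mu>, \<xi>) (\<mu>, x) < \<delta>"
      using \<xi> \<open>\<not> x + \<delta> \<le> y\<close> by (simp add: dist_Pair_Pair dist_real_def)
    moreover have "(\<mu>, x) \<in> S" "(\<mu>, \<xi>) \<in> S" using \<mu> xy \<xi> by (auto simp: S_def)
    ultimately have "\<bar>Q (\<mu>, x)\<bar> < \<bar>Q z0\<bar>" using \<delta>[of "(\<mu>, x)" "(\<mu>, \<xi>)"] by (simp add: Q_def)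
    moreover have "\<bar>Q z0\<bar> \<le> \<bar>Q (\<mu>, x)\<bar>" using z0(3) \<open>(\<mu>, x) \<in> S\<close> zero by (simp add: V_def)
    ultimately show False by simp
  qed
  have persists: "\<exists>\<eta>>0. \<forall>\<nu>\<in>{0..M}. \<bar>\<nu> - \<mu>\<bar> < \<eta> \<longrightarrow> (\<exists>y. \<bar>y - x\<bar> < \<epsilon> \<and> a < y \<and> y < b \<and> U \<nu> y = 0)"
    if "\<mu> \<in> {0..M}" "a < x" "x < b" "U \<mu> x = 0" "\<epsilon> > 0" for \<mu> x \<epsilon>
  proof (rule simple_zero_persists[where P=P, OF contU])
    show "(U \<mu> has_real_derivative P \<mu> y) (at y within {a..b})" if "y \<in> {a..b}" for y
      using deriv \<open>\<mu> \<in> {0..M}\<close> that .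
  qed (use that simple[of \<mu> x] in auto)

  \<comment> \<open>The closed condition \<open>a + \<delta> \<le> snd z\<close> stands in for the
    open one that the zero lies beyond \<open>a\<close>; on zeros the two agree, by
    \<open>sep\<close> applied to the zero at \<open>a\<close>.\<close>
  define K1 where "K1 = {z \<in> S. V z = 0} \<inter> {z. a + \<delta> \<le> snd z}"
  have K1: "compact K1"
    unfolding K1_def by (intro compact_Int_closed Z closed_Collect_le continuous_intros)
  have K1_I: "(\<mu>, x) \<in> K1" if "\<mu> \<in> {0..M}" "a < x" "x \<le> b" "U \<mu> x = 0" for \<mu> x
    using that sep[of \<mu> a x] left[of \<mu>] by (auto simp: K1_def S_def V_def)
  have "(M, c) \<in> K1" using two \<open>0 < M\<close> by (intro K1_I) auto
  then obtain z1 where z1: "z1 \<in> K1" "\<And>z. z \<in> K1 \<Longrightarrow> fst z1 \<le> fst z"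
    using continuous_attains_inf[OF K1, of fst] continuous_on_fst[OF continuous_on_id] by blast
  obtain \<mu>1 x1 where z1_eq: "z1 = (\<mu>1, x1)" by (cases z1)
  have min1: "\<mu>1 \<le> \<mu>" if "\<mu> \<in> {0..M}" "a < x" "x \<le> b" "U \<mu> x = 0" for \<mu> x
    using z1(2)[OF K1_I[OF that]] by (simp add: z1_eq)
  have 1: "\<mu>1 \<in> {0..M}" "a < x1" "x1 \<le> b" "U \<mu>1 x1 = 0"
    using z1(1) \<open>\<delta> > 0\<close> by (auto simp: z1_eq K1_def S_def V_def)
  then have "\<mu>1 > 0" using none[of x1] by (cases "\<mu>1 = 0") auto
  have no_interior: False if x: "a < x" "x < b" "U \<mu>1 x = 0" for x
  proof -
    obtain \<eta> where \<eta>: "\<eta> > 0" "\<forall>\<nu>\<in>{0..M}. \<bar>\<nu> - \<mu>1\<bar> < \<eta> \<longrightarrow> (\<exists>y. \<bar>y - x\<bar> < 1 \<and> a < y \<and> y < b \<and> U \<nu> y = 0)"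
      using persists[OF 1(1) x, of 1] by auto
    \<comment> \<open>Taking half of the minimum keeps \<nu> positive, within \<eta> of \<mu>1 and
      strictly below it, so that a zero at \<nu> contradicts the minimality of \<mu>1.\<close>
    define \<nu> where "\<nu> = \<mu>1 - min \<eta> \<mu>1 / 2"
    have \<nu>: "\<nu> \<in> {0..M}" "\<bar>\<nu> - \<mu>1\<bar> < \<eta>" "\<nu> < \<mu>1"
      using \<eta>(1) \<open>\<mu>1 > 0\<close> 1(1) by (auto simp: \<nu>_def min_def)
    then obtain y where "a < y" "y < b" "U \<nu> y = 0" using \<eta>(2) by blast
    then show False using min1[of \<nu> y] \<nu> by auto
  qed
  then have end1: "U \<mu>1 b = 0" using 1 by (cases "x1 = b") force+

  define S2 where "S2 = {0..M} \<times> {a..b} \<times> {a..b}"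
  have S2: "compact S2" unfolding S2_def by (intro compact_Times compact_Icc)
  have V12: "continuous_on S2 (\<lambda>z. V (fst z, fst (snd z)))" "continuous_on S2 (\<lambda>z. V (fst z, snd (snd z)))"
    by (intro continuous_on_compose2[OF V] continuous_intros; auto simp: S2_def S_def)+
  define K2 where "K2 = S2 \<inter> ({z \<in> S2. V (fst z, fst (snd z)) = 0} \<inter> {z \<in> S2. V (fst z, snd (snd z)) = 0} \<inter>
    {z. a + \<delta> \<le> fst (snd z)} \<inter> {z. fst (snd z) + \<delta> \<le> snd (snd z)})"
  have K2: "compact K2"
    unfolding K2_def
    by (intro compact_Int_closed S2 closed_Int closed_zeros V12 closed_Collect_le continuous_intros)
  have K2_I: "(\<mu>, x, y) \<in> K2"
    if "\<mu> \<in> {0..M}" "a < x" "x < y" "y \<le> b" "U \<mu> x = 0" "U \<mu> y = 0" for \<mu> x y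
    using that sep[of \<mu> a x] sep[of \<mu> x y] left[of \<mu>] by (auto simp: K2_def S2_def V_def)
  have "(M, c, d) \<in> K2" using two \<open>0 < M\<close> by (intro K2_I) auto
  then obtain z2 where z2: "z2 \<in> K2" "\<And>z. z \<in> K2 \<Longrightarrow> fst z2 \<le> fst z"
    using continuous_attains_inf[OF K2, of fst] continuous_on_fst[OF continuous_on_id] by blast
  obtain \<mu>2 x2 y2 where z2_eq: "z2 = (\<mu>2, x2, y2)" by (cases z2)
  have 2: "\<mu>2 \<in> {0..M}" "a < x2" "x2 < y2" "y2 \<le> b" "U \<mu>2 x2 = 0" "U \<mu>2 y2 = 0"
    using z2(1) \<open>\<delta> > 0\<close> by (auto simp: z2_eq K2_def S2_def V_def)
  have "\<mu>2 > 0" using 2 none[of x2] by (cases "\<mu>2 = 0") auto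
  \<comment> \<open>Of two zeros beyond \<open>a\<close> the smaller is interior, which is excluded
    at \<mu>1.\<close>
  have "\<mu>1 \<noteq> \<mu>2" using no_interior[of x2] 2 by auto
  moreover have "y2 = b"
  proof (rule ccontr)
    assume "y2 \<noteq> b"
    \<comment> \<open>With half the gap as radius, the zeros persisting from \<open>x2\<close> and
      \<open>y2\<close> stay distinct and in order, so \<nu> again has two zeros.\<close>
    define \<epsilon> where "\<epsilon> = (y2 - x2) / 2"
    have "\<epsilon> > 0" using 2 by (simp add: \<epsilon>_def)
    obtain \<eta> where \<eta>: "\<eta> > 0" "\<forall>\<nu>\<in>{0..M}. \<bar>\<nu> - \<mu>2\<bar> < \<eta> \<longrightarrow> (\<exists>y. \<bar>y - x2\<bar> < \<epsilon> \<and> a < y \<and> y < b \<and> U \<nu> y = 0)"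
      using persists[OF 2(1) 2(2) _ 2(5) \<open>\<epsilon> > 0\<close>] 2 by auto
    obtain \<eta>' where \<eta>': "\<eta>' > 0" "\<forall>\<nu>\<in>{0..M}. \<bar>\<nu> - \<mu>2\<bar> < \<eta>' \<longrightarrow> (\<exists>y. \<bar>y - y2\<bar> < \<epsilon> \<and> a < y \<and> y < b \<and> U \<nu> y = 0)"
      using persists[OF 2(1) _ _ 2(6) \<open>\<epsilon> > 0\<close>] 2 \<open>y2 \<noteq> b\<close> by auto
    define \<nu> where "\<nu> = \<mu>2 - Min {\<eta>, \<eta>', \<mu>2} / 2"
    have "Min {\<eta>, \<eta>', \<mu>2} > 0" using \<eta>(1) \<eta>'(1) \<open>\<mu>2 > 0\<close> by simp
    then have \<nu>: "\<nu> \<in> {0..M}" "\<bar>\<nu> - \<mu>2\<bar> < \<eta>" "\<bar>\<nu> - \<mu>2\<bar> < \<eta>'" "\<nu> < \<mu>2"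
      using 2(1) by (auto simp: \<nu>_def)
    obtain x where x: "\<bar>x - x2\<bar> < \<epsilon>" "a < x" "U \<nu> x = 0" using \<eta>(2) \<nu> by blast
    obtain y where y: "\<bar>y - y2\<bar> < \<epsilon>" "y < b" "U \<nu> y = 0" using \<eta>'(2) \<nu> by blast
    have "x < y" using x(1) y(1) unfolding \<epsilon>_def abs_less_iff by argo
    then have "\<mu>2 \<le> \<nu>" using z2(2)[OF K2_I[of \<nu> x y]] \<nu> x y by (simp add: z2_eq)
    then show False using \<nu> by simp
  qed
  ultimately show ?thesis using 1(1) 2(1,6) end1 by blast
qed

section \<open>Positivity and oscillation\<close>

text \<open>The forward inequality for the reflected function. It carries vanishing data from a zero
  of a solution back to the left endpoint.\<close>

lemma gronwall_integral_backward:
  fixes f :: "real \<Rightarrow> real"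
  assumes cont: "continuous_on {a..b} f" and "K \<ge> 0"
    and le: "\<And>x. x \<in> {a..b} \<Longrightarrow> f x \<le> A + K * integral {x..b} f"
    and x: "x \<in> {a..b}"
  shows "f x \<le> A * exp (K * (b - x))"
proof -
  have "(\<lambda>t. f (- t)) (- x) \<le> A * exp (K * (- x - (- b)))"
  proof (rule gronwall_integral[where b="-a"])
    show "continuous_on {- b..- a} (\<lambda>t. f (- t))"
      by (intro continuous_on_compose2[OF cont] continuous_intros) auto
    show "f (- t) \<le> A + K * integral {- b..t} (\<lambda>t. f (- t))" if "t \<in> {- b..- a}" for t
      using le[of "- t"] that Henstock_Kurzweil_Integration.integral_reflect_real[of b "- t" f] by simp
  qed (use x \<open>K \<ge> 0\<close> in auto)
  then show ?thesis by simp
qed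

lemma ivp_solution_increment:
  fixes u p :: "real \<Rightarrow> 'a::euclidean_space"
  assumes sol: "ivp_solution a b q c u p"
    and q: "q \<in> borel_measurable lebesgue" "\<And>t. \<bar>q t\<bar> \<le> K"
    and st: "a \<le> s" "s \<le> t" "t \<le> b"
  shows "u t - u s = integral {s..t} p" "p t - p s = integral {s..t} (\<lambda>t. q t *\<^sub>R u t)"
proof -
  have cont: "continuous_on {a..b} u" "continuous_on {a..b} p" using sol by (auto simp: ivp_solution_def)
  have "p integrable_on {a..t}"
    using st by (intro integrable_continuous_real continuous_on_subset[OF cont(2)]) auto
  then have "integral {a..s} p + integral {s..t} p = integral {a..t} p"
    using st by (intro Henstock_Kurzweil_Integration.integral_combine)
  moreover have "(\<lambda>t. q t *\<^sub>R u t) integrable_on {a..t}"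
    by (rule integrable_scaleR_continuous[OF q cont(1)]) (use st in auto)
  then have "integral {a..s} (\<lambda>t. q t *\<^sub>R u t) + integral {s..t} (\<lambda>t. q t *\<^sub>R u t) = integral {a..t} (\<lambda>t. q t *\<^sub>R u t)"
    using st by (intro Henstock_Kurzweil_Integration.integral_combine)
  ultimately show "u t - u s = integral {s..t} p" "p t - p s = integral {s..t} (\<lambda>t. q t *\<^sub>R u t)"
    using sol st unfolding ivp_solution_def by (auto simp: algebra_simps)
qed

lemma ivp_solution_initial:
  assumes "ivp_solution a b q c u p" "a \<le> b"
  shows "u a = 0" "p a = c"
  using assms by (auto simp: ivp_solution_def)

text \<open>If \<open>p x\<close> vanished together with \<open>u x\<close>, backward Gronwall with
  \<open>A = 0\<close> for \<open>norm (u t) + norm (p t)\<close> would give \<open>p a = 0\<close>,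
  against the initial slope.\<close>

lemma ivp_solution_zero_simple:
  fixes u p :: "real \<Rightarrow> 'a::euclidean_space"
  assumes sol: "ivp_solution a b q c u p" and "c \<noteq> 0"
    and q: "q \<in> borel_measurable lebesgue" "\<And>t. \<bar>q t\<bar> \<le> K"
    and x: "x \<in> {a..b}" and zero: "u x = 0"
  shows "p x \<noteq> 0"
proof
  assume "p x = 0"
  have cont: "continuous_on {a..x} u" "continuous_on {a..x} p"
    using sol x by (auto simp: ivp_solution_def intro: continuous_on_subset)
  have "K \<ge> 0" using q(2)[of a] by linarith
  have "norm (u a) + norm (p a) \<le> 0 * exp ((K + 1) * (x - a))"
  proof (rule gronwall_integral_backward)
    fix t assume t: "t \<in> {a..x}"
    have ix: "g integrable_on {t..x}" if "continuous_on {a..x} g" for g :: "real \<Rightarrow> 'b::euclidean_space"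
      using t by (intro integrable_continuous_real continuous_on_subset[OF that]) auto
    have nonneg: "integral {t..x} (\<lambda>t. norm (g t)) \<ge> 0" if "continuous_on {a..x} g" for g :: "real \<Rightarrow> 'a"
      by (intro Henstock_Kurzweil_Integration.integral_nonneg ix continuous_intros that) auto
    note inc = ivp_solution_increment[OF sol q, of t x]
    have "norm (u t) = norm (u x - u t)" using zero by simp
    also have "\<dots> = norm (integral {t..x} p)"
      using inc(1) t x by simp
    also have "\<dots> \<le> integral {t..x} (\<lambda>t. norm (p t))"
      by (intro Henstock_Kurzweil_Integration.integral_norm_bound_integral ix continuous_intros cont) auto
    finally have 1: "norm (u t) \<le> integral {t..x} (\<lambda>t. norm (p t))" .
    have "norm (p t) = norm (p x - p t)" using \<open>p x = 0\<close> by simp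
    also have "\<dots> = norm (integral {t..x} (\<lambda>t. q t *\<^sub>R u t))"
      using inc(2) t x by simp
    also have "\<dots> \<le> integral {t..x} (\<lambda>t. K * norm (u t))"
    proof (rule Henstock_Kurzweil_Integration.integral_norm_bound_integral)
      show "(\<lambda>t. q t *\<^sub>R u t) integrable_on {t..x}"
        by (rule integrable_scaleR_continuous[OF q cont(1)]) (use t in auto)
      show "(\<lambda>t. K * norm (u t)) integrable_on {t..x}"
        by (intro ix continuous_intros cont)
      show "norm (q t *\<^sub>R u t) \<le> K * norm (u t)" for t
        using q(2)[of t] by (simp add: mult_right_mono)
    qed
    finally have 2: "norm (p t) \<le> K * integral {t..x} (\<lambda>t. norm (u t))" by simp
    have "integral {t..x} (\<lambda>t. norm (u t) + norm (p t)) =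
        integral {t..x} (\<lambda>t. norm (u t)) + integral {t..x} (\<lambda>t. norm (p t))"
      by (intro Henstock_Kurzweil_Integration.integral_add ix continuous_intros cont)
    then show "norm (u t) + norm (p t) \<le> 0 + (K + 1) * integral {t..x} (\<lambda>t. norm (u t) + norm (p t))"
      using 1 2 nonneg[OF cont(1)] mult_nonneg_nonneg[OF \<open>K \<ge> 0\<close> nonneg[OF cont(2)]]
      by (simp only: distrib_left distrib_right mult_1)
  qed (use x \<open>K \<ge> 0\<close> in \<open>auto intro!: continuous_intros cont\<close>)
  then have "p a = 0" by (smt (verit) mult_zero_left norm_ge_zero norm_eq_zero)
  then show False using ivp_solution_initial[OF sol] x \<open>c \<noteq> 0\<close> by auto
qed

lemma integral_ge_const:
  fixes f :: "real \<Rightarrow> real"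
  assumes "continuous_on {s..t} f" "s \<le> t" "\<And>x. x \<in> {s..t} \<Longrightarrow> k \<le> f x"
  shows "k * (t - s) \<le> integral {s..t} f"
  using integral_le[of "\<lambda>_. k" "{s..t}" f] assms integrable_continuous_real[OF assms(1)]
    integrable_const_ivl[of k s t]
  by (simp add: mult.commute)

text \<open>Comparison with the solution x - a for zero coefficient. As long as p \<ge> 0, also u
  \<ge> 0, so the integral of q u is nonnegative and p \<ge> 1; hence there is no first point at
  which \<open>p\<close> fails to be positive.\<close>

lemma ivp_solution_ge:
  fixes u p :: "real \<Rightarrow> real"
  assumes sol: "ivp_solution a b q 1 u p"
    and q: "q \<in> borel_measurable lebesgue" "\<And>t. \<bar>q t\<bar> \<le> K" "\<And>t. 0 \<le> q t"
    and x: "x \<in> {a..b}"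
  shows "x - a \<le> u x"
proof -
  have cont: "continuous_on {a..b} u" "continuous_on {a..b} p"
    using sol by (auto simp: ivp_solution_def)
  have contx: "continuous_on {a..x} g" if "continuous_on {a..b} g" "x \<in> {a..b}" for g :: "real \<Rightarrow> real" and x
    using that by (auto intro: continuous_on_subset)
  have p_ge: "p t \<ge> 1" if t: "t \<in> {a..b}" and nonneg: "\<And>s. s \<in> {a..t} \<Longrightarrow> p s \<ge> 0" for t
  proof -
    have u: "u s \<ge> 0" if s: "s \<in> {a..t}" for s
    proof -
      have "0 * (s - a) \<le> integral {a..s} p"
        using s t nonneg by (intro integral_ge_const contx[OF cont(2)]) auto
      then show ?thesis using sol s t by (simp add: ivp_solution_def)
    qed
    have "(\<lambda>s. q s * u s) integrable_on {a..t}"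
      using integrable_scaleR_continuous[OF q(1,2) cont(1), of a t] t by simp
    then have "0 \<le> integral {a..t} (\<lambda>s. q s * u s)"
      by (rule Henstock_Kurzweil_Integration.integral_nonneg) (use q(3) u in auto)
    then show ?thesis using sol t by (simp add: ivp_solution_def)
  qed
  have p_pos: "p t > 0" if "t \<in> {a..b}" for t
  proof (rule ccontr)
    assume "\<not> p t > 0"
    define Z where "Z = {t \<in> {a..b}. p t \<le> 0}"
    have "closed Z"
      unfolding Z_def by (intro continuous_on_closed_Collect_le cont continuous_intros closed_atLeastAtMost)
    then have "compact Z"
      by (metis Z_def compact_Icc compact_Int_closed inf.absorb_iff2 mem_Collect_eq subsetI)
    moreover have "t \<in> Z" using that \<open>\<not> p t > 0\<close> by (simp add: Z_def)
    ultimately obtain t0 where t0: "t0 \<in> Z" "\<And>t. t \<in> Z \<Longrightarrow> t0 \<le> t"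
      using compact_attains_inf[of Z] by blast
    have "p a = 1" using ivp_solution_initial[OF sol] x by auto
    then have "a < t0" using t0(1) by (cases "t0 = a") (auto simp: Z_def)
    have "p s \<ge> 0" if "s \<in> {a<..<t0}" for s
      using t0(2)[of s] that t0(1) by (fastforce simp: Z_def)
    then have "p s \<ge> 0" if "s \<in> {a..t0}" for s
      using continuous_ge_on_Ioo[of a t0 p 0 s] contx[OF cont(2)] t0(1) \<open>a < t0\<close> that
      by (auto simp: Z_def)
    then show False using p_ge[of t0] t0(1) by (auto simp: Z_def)
  qed
  have "1 * (x - a) \<le> integral {a..x} p"
    using x p_pos by (intro integral_ge_const contx[OF cont(2)] p_ge) (auto intro: less_imp_le)
  then show ?thesis using sol x by (simp add: ivp_solution_def)
qed

text \<open>
  A concave positive \<open>u\<close> is monotone on one half of \<open>[c, d]\<close>. On the inner quarter of that half the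
  bound on \<open>p'\<close> makes \<open>p\<close> so large that \<open>u\<close> would cross zero on the outer quarter.
\<close>

lemma no_positive_supersolution:
  fixes u p :: "real \<Rightarrow> real"
  assumes cont: "continuous_on {c..d} u" "continuous_on {c..d} p"
    and u_inc: "\<And>s t. c \<le> s \<Longrightarrow> s \<le> t \<Longrightarrow> t \<le> d \<Longrightarrow> u t - u s = integral {s..t} p"
    and p_inc: "\<And>s t. c \<le> s \<Longrightarrow> s \<le> t \<Longrightarrow> t \<le> d \<Longrightarrow> p t - p s \<le> - \<kappa> * integral {s..t} u"
    and "\<kappa> \<ge> 0" "c \<le> d" "\<kappa> * (d - c)\<^sup>2 \<ge> 16"
    and pos: "\<And>x. x \<in> {c..d} \<Longrightarrow> u x > 0"
  shows False
proof -
  \<comment> \<open>The interval is cut into quarters, and 16 is the square of 4: the hypothesis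
    becomes \<open>\<kappa> * (h * h) \<ge> 1\<close>.\<close>
  define h where "h = (d - c) / 4"
  have h: "h \<ge> 0" "\<kappa> * (h * h) \<ge> 1" using assms by (simp_all add: h_def power2_eq_square)
  have cd: "d = c + 4 * h" by (simp add: h_def field_simps)
  have sub: "continuous_on {s..t} u" "continuous_on {s..t} p" if "c \<le> s" "t \<le> d" for s t
    using that cont by (auto intro: continuous_on_subset)
  have p_anti: "p t \<le> p s" if "c \<le> s" "s \<le> t" "t \<le> d" for s t
  proof -
    have "0 * (t - s) \<le> integral {s..t} u"
      using that pos by (intro integral_ge_const sub) (auto intro: less_imp_le)
    then have "0 \<le> \<kappa> * integral {s..t} u" using \<open>\<kappa> \<ge> 0\<close> by simp
    then show ?thesis using p_inc[OF that] by simp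
  qed
  have step: "\<kappa> * h * k * h \<ge> k" if "k \<ge> 0" for k
    using mult_right_mono[OF h(2) that] by (simp add: mult_ac)
  \<comment> \<open>The midpoint. As \<open>p\<close> is nonincreasing, its sign at \<open>m\<close>
    decides whether \<open>u\<close> increases on the left half or decreases on the right
    half.\<close>
  define m where "m = c + 2 * h"
  show False
  proof (cases "p m \<ge> 0")
    case True
    have u_mono: "u s \<le> u t" if "c \<le> s" "s \<le> t" "t \<le> m" for s t
    proof -
      have "0 * (t - s) \<le> integral {s..t} p"
        using that h by (intro integral_ge_const sub order_trans[OF True] p_anti) (auto simp: m_def cd)
      then show ?thesis using u_inc[of s t] that h by (auto simp: m_def cd)
    qed
    define c' where "c' = c + h"
    have c': "c \<le> c'" "c' \<le> m" "m \<le> d" using h by (auto simp: c'_def m_def cd)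
    have "u c' * (m - c') \<le> integral {c'..m} u"
      using c' by (intro integral_ge_const sub u_mono) auto
    then have "\<kappa> * (u c' * h) \<le> \<kappa> * integral {c'..m} u"
      using \<open>\<kappa> \<ge> 0\<close> by (intro mult_left_mono) (auto simp: m_def c'_def)
    also have "\<dots> \<le> p c'" using p_inc[of c' m] c' True by simp
    finally have "\<kappa> * h * u c' * h \<le> p c' * h" using h by (intro mult_right_mono) (simp_all add: mult_ac)
    moreover have "p c' * (c' - c) \<le> integral {c..c'} p"
      using c' by (intro integral_ge_const sub p_anti) auto
    \<comment> \<open>By \<open>step\<close> the left side is at least \<open>u c'\<close>, which
      leaves \<open>u c \<le> 0\<close>.\<close>
    ultimately have "\<kappa> * h * u c' * h \<le> u c' - u c" using u_inc[of c c'] c' by (simp add: c'_def)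
    moreover have "u c' > 0" "u c > 0" using c' by (auto intro!: pos)
    ultimately show False using step[of "u c'"] by linarith
  next
    case False
    have u_anti: "u t \<le> u s" if "m \<le> s" "s \<le> t" "t \<le> d" for s t
    proof -
      have "- p x \<ge> 0" if "x \<in> {s..t}" for x
        using p_anti[of m x] that \<open>m \<le> s\<close> \<open>t \<le> d\<close> False h by (auto simp: m_def)
      then have "0 * (t - s) \<le> integral {s..t} (\<lambda>x. - p x)"
        using that h by (intro integral_ge_const continuous_intros sub) (auto simp: m_def)
      then show ?thesis using u_inc[of s t] that h by (auto simp: m_def cd)
    qed
    define d' where "d' = d - h"
    have d': "c \<le> m" "m \<le> d'" "d' \<le> d" using h by (auto simp: d'_def m_def cd)
    have "u d' * (d' - m) \<le> integral {m..d'} u"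
      using d' by (intro integral_ge_const sub u_anti) auto
    then have "\<kappa> * (u d' * h) \<le> \<kappa> * integral {m..d'} u"
      using \<open>\<kappa> \<ge> 0\<close> by (intro mult_left_mono) (auto simp: m_def d'_def cd)
    also have "\<dots> \<le> - p d'" using p_inc[of m d'] d' False by simp
    finally have "\<kappa> * h * u d' * h \<le> - p d' * h" using h by (intro mult_right_mono) (simp_all add: mult_ac)
    moreover have "- p d' * (d - d') \<le> integral {d'..d} (\<lambda>x. - p x)"
      using d' by (intro integral_ge_const continuous_intros sub) (auto intro: p_anti)
    ultimately have "\<kappa> * h * u d' * h \<le> u d' - u d" using u_inc[of d' d] d' by (simp add: d'_def)
    moreover have "u d' > 0" "u d > 0" using d' by (auto intro!: pos)
    ultimately show False using step[of "u d'"] by linarith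
  qed
qed

text \<open>A solution without zeros on the interval has constant sign there by connectedness.
  Multiplied by a suitable \<sigma> = 1 or -1 it is positive, and q \<le> -\<kappa> then yields the
  differential inequality that \<open>no_positive_supersolution\<close> refutes.\<close>

lemma ivp_solution_oscillates:
  fixes u p :: "real \<Rightarrow> real"
  assumes sol: "ivp_solution a b q k u p"
    and q: "q \<in> borel_measurable lebesgue" "\<And>t. \<bar>q t\<bar> \<le> K"
    and cd: "a \<le> c" "c \<le> d" "d \<le> b" and neg: "\<And>t. t \<in> {c..d} \<Longrightarrow> q t \<le> - \<kappa>"
    and "\<kappa> \<ge> 0" "\<kappa> * (d - c)\<^sup>2 \<ge> 16"
  shows "\<exists>x\<in>{c..d}. u x = 0"
proof (rule ccontr)
  assume nz: "\<not> ?thesis"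
  have cont: "continuous_on {c..d} u" "continuous_on {c..d} p"
    using sol cd by (auto simp: ivp_solution_def intro: continuous_on_subset)
  have key: False
    if \<sigma>: "\<bar>\<sigma>\<bar> = 1" and pos: "\<And>x. x \<in> {c..d} \<Longrightarrow> \<sigma> * u x > 0" for \<sigma> :: real
  proof (rule no_positive_supersolution[of c d "\<lambda>x. \<sigma> * u x" "\<lambda>x. \<sigma> * p x" \<kappa>])
    fix s t assume st: "c \<le> s" "s \<le> t" "t \<le> d"
    note inc = ivp_solution_increment[OF sol q, of s t]
    show "\<sigma> * u t - \<sigma> * u s = integral {s..t} (\<lambda>x. \<sigma> * p x)"
      using inc(1) st cd by (simp flip: right_diff_distrib)
    have int: "(\<lambda>x. \<sigma> * u x) integrable_on {s..t}" "u integrable_on {s..t}"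
      using st by (auto intro!: integrable_continuous_real continuous_intros continuous_on_subset[OF cont(1)])
    have "\<sigma> * p t - \<sigma> * p s = integral {s..t} (\<lambda>t. \<sigma> * (q t * u t))"
      using inc(2) st cd by (simp flip: right_diff_distrib)
    also have "\<dots> \<le> integral {s..t} (\<lambda>t. - \<kappa> * (\<sigma> * u t))"
    proof (rule integral_le)
      have "(\<lambda>t. q t * u t) integrable_on {s..t}"
        using integrable_scaleR_continuous[OF q cont(1), of s t] st by simp
      then show "(\<lambda>t. \<sigma> * (q t * u t)) integrable_on {s..t}"
        by (rule integrable_on_mult_right)
      show "(\<lambda>t. - \<kappa> * (\<sigma> * u t)) integrable_on {s..t}"
        by (intro integrable_on_mult_right int)
      show "\<sigma> * (q x * u x) \<le> - \<kappa> * (\<sigma> * u x)" if "x \<in> {s..t}" for x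
        using mult_right_mono[OF neg[of x], of "\<sigma> * u x"] pos[of x] that st by (simp add: mult_ac)
    qed
    finally show "\<sigma> * p t - \<sigma> * p s \<le> - \<kappa> * integral {s..t} (\<lambda>x. \<sigma> * u x)" by simp
  qed (use assms pos in \<open>auto intro!: continuous_intros cont\<close>)
  have conn: "connected (u ` {c..d})" by (intro connected_continuous_image cont) auto
  show False
  proof (cases "u c > 0")
    case True
    have "u x > 0" if "x \<in> {c..d}" for x
    proof (rule ccontr)
      assume "\<not> u x > 0"
      then have "0 \<in> u ` {c..d}"
        using that True cd by - (rule connectedD_interval[OF conn, of "u x" "u c"], auto)
      then show False using nz by auto
    qed
    then show False using key[of 1] by simp
  next
    case False
    then have "u c < 0" using nz cd by force
    have "u x < 0" if "x \<in> {c..d}" for x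
    proof (rule ccontr)
      assume "\<not> u x < 0"
      then have "0 \<in> u ` {c..d}"
        using that \<open>u c < 0\<close> cd by - (rule connectedD_interval[OF conn, of "u c" "u x"], auto)
      then show False using nz by auto
    qed
    then show False using key[of "-1"] by simp
  qed
qed

section \<open>Joint continuity in parameter and position, and the two shooting parameters\<close>

lemma continuous_on_Times_Lipschitz:
  fixes F :: "real \<Rightarrow> 'b::topological_space \<Rightarrow> real"
  assumes cont: "\<And>\<nu>. \<nu> \<in> I \<Longrightarrow> continuous_on S (F \<nu>)"
    and lip: "\<And>\<nu>. \<nu> \<in> I \<Longrightarrow> \<exists>C. \<forall>\<mu>\<in>I. \<forall>x\<in>S. \<bar>F \<mu> x - F \<nu> x\<bar> \<le> C * \<bar>\<mu> - \<nu>\<bar>"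
  shows "continuous_on (I \<times> S) (\<lambda>(\<mu>, x). F \<mu> x)"
  unfolding continuous_on_def
proof
  fix z assume z: "z \<in> I \<times> S"
  obtain \<nu> y where z_eq: "z = (\<nu>, y)" by (cases z)
  then obtain C where C: "\<And>\<mu> x. \<mu> \<in> I \<Longrightarrow> x \<in> S \<Longrightarrow> \<bar>F \<mu> x - F \<nu> x\<bar> \<le> C * \<bar>\<mu> - \<nu>\<bar>"
    using lip[of \<nu>] z by auto
  have \<nu>: "\<nu> \<in> I" using z z_eq by simp
  \<comment> \<open>The increment is split into a change of position at fixed \<nu>, handled by
    continuity, and a change of parameter, handled by the bound uniform in x. \<open>C\<close> may
    depend on \<nu>, as it does for solutions, where it contains a bound of the solution at
    \<nu>.\<close>
  have "continuous_on (I \<times> S) (\<lambda>w. F \<nu> (snd w))"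
    by (intro continuous_on_compose2[OF cont[OF \<nu>]] continuous_intros) auto
  then have 1: "((\<lambda>w. F \<nu> (snd w)) \<longlongrightarrow> F \<nu> y) (at z within I \<times> S)"
    using z unfolding continuous_on_def z_eq by fastforce
  have "((\<lambda>w. C * \<bar>fst w - \<nu>\<bar>) \<longlongrightarrow> C * \<bar>fst z - \<nu>\<bar>) (at z within I \<times> S)"
    by (intro tendsto_intros)
  then have "((\<lambda>w. C * \<bar>fst w - \<nu>\<bar>) \<longlongrightarrow> 0) (at z within I \<times> S)" by (simp add: z_eq)
  moreover have "\<forall>\<^sub>F w in at z within I \<times> S. norm (F (fst w) (snd w) - F \<nu> (snd w)) \<le> C * \<bar>fst w - \<nu>\<bar>"
    using C by (auto simp: eventually_at_filter intro!: always_eventually)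
  ultimately have "((\<lambda>w. F (fst w) (snd w) - F \<nu> (snd w)) \<longlongrightarrow> 0) (at z within I \<times> S)"
    by (rule Lim_null_comparison[rotated])
  from tendsto_add[OF this 1]
  show "((\<lambda>(\<mu>, x). F \<mu> x) \<longlongrightarrow> (case z of (\<mu>, x) \<Rightarrow> F \<mu> x)) (at z within I \<times> S)"
    by (simp add: z_eq case_prod_unfold)
qed

lemma ivp_solution_deriv:
  fixes u p :: "real \<Rightarrow> 'a::euclidean_space"
  assumes "ivp_solution a b q c u p" "x \<in> {a..b}"
  shows "(u has_vector_derivative p x) (at x within {a..b})"
proof (rule has_vector_derivative_transform)
  show "((\<lambda>x. integral {a..x} p) has_vector_derivative p x) (at x within {a..b})"
    using assms by (intro integral_has_vector_derivative) (auto simp: ivp_solution_def)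
qed (use assms in \<open>auto simp: ivp_solution_def\<close>)

lemma two_dirichlet_solutions:
  fixes v :: "real \<Rightarrow> real"
  assumes v: "v \<in> borel_measurable lebesgue" "\<And>x. 0 \<le> v x" "\<And>x. v x \<le> B"
    and ab: "a < c" "c \<le> d" "d < c'" "c' \<le> d'" "d' \<le> b"
    and le: "\<And>x. x \<in> {c..d} \<union> {c'..d'} \<Longrightarrow> v x \<le> M - \<kappa>"
    and "M > 0" "\<kappa> \<ge> 0" "\<kappa> * (d - c)\<^sup>2 \<ge> 16" "\<kappa> * (d' - c')\<^sup>2 \<ge> 16"
  shows "\<exists>\<mu>1 \<mu>2. \<mu>1 \<noteq> \<mu>2 \<and> (\<forall>\<mu>\<in>{\<mu>1, \<mu>2}. \<mu> \<le> M \<and>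
    (\<exists>u p. ivp_solution a b (\<lambda>x. v x - \<mu>) (1::real) u p \<and> u b = 0))"
proof -
  have meas: "(\<lambda>x. v x - \<mu>) \<in> borel_measurable lebesgue" for \<mu> using v(1) by simp
  have bound: "\<bar>v x - \<mu>\<bar> \<le> B + \<bar>\<mu>\<bar>" for x \<mu> using v(2)[of x] v(3)[of x] by linarith
  have "\<forall>\<mu>. \<exists>u p. ivp_solution a b (\<lambda>x. v x - \<mu>) (1::real) u p"
    using ivp_solution_exists[OF meas bound] ab by simp
  then obtain U P where sol: "\<And>\<mu>. ivp_solution a b (\<lambda>x. v x - \<mu>) (1::real) (U \<mu>) (P \<mu>)"
    by metis
  have cont: "continuous_on {a..b} (U \<mu>)" "continuous_on {a..b} (P \<mu>)" for \<mu>
    using sol[of \<mu>] by (auto simp: ivp_solution_def)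
  have dep: "\<exists>C. \<forall>\<mu>\<in>{0..M}. \<forall>x\<in>{a..b}. \<bar>U \<mu> x - U \<nu> x\<bar> + \<bar>P \<mu> x - P \<nu> x\<bar> \<le> C * \<bar>\<mu> - \<nu>\<bar>"
    if \<nu>: "\<nu> \<in> {0..M}" for \<nu>
  proof -
    have "bounded (U \<nu> ` {a..b})"
      by (intro compact_imp_bounded compact_continuous_image cont) auto
    then obtain D where D: "\<And>x. x \<in> {a..b} \<Longrightarrow> norm (U \<nu> x) \<le> D"
      by (metis bounded_iff imageI)
    have "D \<ge> 0" using order_trans[OF norm_ge_zero D[of a]] ab by simp
    have "B \<ge> 0" using v(2)[of 0] v(3)[of 0] by linarith
    have "\<bar>U \<mu> x - U \<nu> x\<bar> + \<bar>P \<mu> x - P \<nu> x\<bar> \<le> D * (b - a) * exp ((B + M + 1) * (b - a)) * \<bar>\<mu> - \<nu>\<bar>"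
      if \<mu>: "\<mu> \<in> {0..M}" and x: "x \<in> {a..b}" for \<mu> x
    proof -
      have K: "\<bar>v t - \<rho>\<bar> \<le> B + M" if "\<rho> \<in> {0..M}" for t \<rho>
        using bound[of t \<rho>] that by auto
      have "\<bar>v t - \<mu> - (v t - \<nu>)\<bar> \<le> \<bar>\<mu> - \<nu>\<bar>" for t by simp
      from ivp_solution_dist[OF sol sol meas K[OF \<mu>] meas K[OF \<nu>] this D x]
      have "\<bar>U \<mu> x - U \<nu> x\<bar> + \<bar>P \<mu> x - P \<nu> x\<bar> \<le> \<bar>\<mu> - \<nu>\<bar> * D * (b - a) * exp ((B + M + 1) * (x - a))"
        by simp
      also have "\<dots> \<le> \<bar>\<mu> - \<nu>\<bar> * D * (b - a) * exp ((B + M + 1) * (b - a))"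
        using x \<open>D \<ge> 0\<close> \<open>B \<ge> 0\<close> \<open>M > 0\<close> by (intro mult_left_mono) auto
      finally show ?thesis by (simp add: mult_ac)
    qed
    then show ?thesis by blast
  qed
  \<comment> \<open>On both intervals the coefficient v - M is at most -\<kappa>, so each contains a
    zero at parameter \<open>M\<close>; the zeros differ since \<open>d < c'\<close>.\<close>
  have zeros: "\<exists>x\<in>{s..t}. U M x = 0"
    if st: "a \<le> s" "s \<le> t" "t \<le> b" "\<kappa> * (t - s)\<^sup>2 \<ge> 16" "{s..t} \<subseteq> {c..d} \<union> {c'..d'}" for s t
  proof (rule ivp_solution_oscillates[OF sol meas bound st(1-3) _ \<open>\<kappa> \<ge> 0\<close> st(4)])
    show "v x - M \<le> - \<kappa>" if "x \<in> {s..t}" for x using le[of x] that st(5) by auto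
  qed
  obtain x y where xy: "x \<in> {c..d}" "y \<in> {c'..d'}" "U M x = 0" "U M y = 0"
    using zeros[of c d] zeros[of c' d'] assms by auto
  have "\<exists>\<mu>1\<in>{0..M}. \<exists>\<mu>2\<in>{0..M}. \<mu>1 \<noteq> \<mu>2 \<and> U \<mu>1 b = 0 \<and> U \<mu>2 b = 0"
  proof (rule two_parameters_vanishing_at_endpoint[where a=a and P=P and c=x and d=y])
    show "continuous_on ({0..M} \<times> {a..b}) (\<lambda>(\<mu>, x). U \<mu> x)"
    proof (rule continuous_on_Times_Lipschitz[OF cont(1)])
      fix \<nu> assume "\<nu> \<in> {0..M}"
      then show "\<exists>C. \<forall>\<mu>\<in>{0..M}. \<forall>x\<in>{a..b}. \<bar>U \<mu> x - U \<nu> x\<bar> \<le> C * \<bar>\<mu> - \<nu>\<bar>"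
        using dep[of \<nu>] by (fastforce elim: order_trans[rotated])
    qed
    show "continuous_on ({0..M} \<times> {a..b}) (\<lambda>(\<mu>, x). P \<mu> x)"
    proof (rule continuous_on_Times_Lipschitz[OF cont(2)])
      fix \<nu> assume "\<nu> \<in> {0..M}"
      then show "\<exists>C. \<forall>\<mu>\<in>{0..M}. \<forall>x\<in>{a..b}. \<bar>P \<mu> x - P \<nu> x\<bar> \<le> C * \<bar>\<mu> - \<nu>\<bar>"
        using dep[of \<nu>] by (fastforce elim: order_trans[rotated])
    qed
    show "(U \<mu> has_real_derivative P \<mu> x) (at x within {a..b})" if "x \<in> {a..b}" for \<mu> x
      using ivp_solution_deriv[OF sol that] by (simp add: has_real_derivative_iff_has_vector_derivative)
    show "U \<mu> a = 0" for \<mu> using ivp_solution_initial(1)[OF sol] ab by simp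
    show "P \<mu> x \<noteq> 0" if "x \<in> {a..b}" "U \<mu> x = 0" for \<mu> x
      using ivp_solution_zero_simple[OF sol _ meas bound that] by simp
    \<comment> \<open>At parameter 0 the coefficient is v \<ge> 0, so the solution is at least x -
      a.\<close>
    show "U 0 x \<noteq> 0" if "x \<in> {a<..b}" for x
      using ivp_solution_ge[OF sol[of 0] meas bound _, of x] v(2) that by simp
  qed (use ab xy \<open>M > 0\<close> in auto)
  then obtain \<mu>1 \<mu>2 where "\<mu>1 \<noteq> \<mu>2" "\<mu>1 \<le> M" "\<mu>2 \<le> M" "U \<mu>1 b = 0" "U \<mu>2 b = 0"
    by auto
  then show ?thesis using sol by (intro exI[of _ \<mu>1] exI[of _ \<mu>2]) blast
qed

section \<open>Eigenvalues\<close>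

text \<open>The potential enters only through an equation that holds almost everywhere. This later
  permits a representative whose bounds hold at every point.\<close>

lemma eigenspace_cong_AE:
  assumes "AE x in lebesgue. v x = w x"
  shows "eigenspace v L = eigenspace w L"
proof -
  have ae: "AE x in lebesgue_on {-L/2<..<L/2}. v x = w x"
    using assms by (subst AE_restrict_space_iff) auto
  have "schrodinger_op v L u f \<longleftrightarrow> schrodinger_op w L u f" for u f
  proof -
    have "(AE x in lebesgue_on {-L/2<..<L/2}. f x = - z x + complex_of_real (v x) * u x) \<longleftrightarrow>
        (AE x in lebesgue_on {-L/2<..<L/2}. f x = - z x + complex_of_real (w x) * u x)" for z
      using ae by (intro eventually_subst) (auto elim: eventually_mono)
    then show ?thesis by (simp add: schrodinger_op_def)
  qed
  then show ?thesis by (simp add: eigenspace_def fun_eq_iff)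
qed

lemma spectral_gap_cong_AE:
  assumes "AE x in lebesgue. v x = w x"
  shows "spectral_gap v L = spectral_gap w L"
  by (simp add: spectral_gap_def eigenvalue_def at_least_eigenvalues_le_def multiplicity_ev_def
      eigenspace_cong_AE[OF assms])

lemma L2_bounded:
  assumes "f \<in> borel_measurable (lebesgue_on {-L/2<..<L/2})" "\<And>x. x \<in> {-L/2<..<L/2} \<Longrightarrow> cmod (f x) \<le> C"
  shows "L2 L f"
proof -
  interpret finite_measure "lebesgue_on {-L/2<..<L/2}"
    by (intro finite_measure_lebesgue_on bounded_set_imp_lmeasurable) auto
  have "integrable (lebesgue_on {-L/2<..<L/2}) (\<lambda>x. (cmod (f x))\<^sup>2)"
  proof (rule integrable_const_bound)
    show "AE x in lebesgue_on {-L/2<..<L/2}. norm ((cmod (f x))\<^sup>2) \<le> C\<^sup>2"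
      using assms(2) by (intro AE_I2) (auto intro!: power_mono)
    show "(\<lambda>x. (cmod (f x))\<^sup>2) \<in> borel_measurable (lebesgue_on {-L/2<..<L/2})"
      using assms(1) by measurable
  qed
  then show ?thesis using assms(1) by (simp add: L2_def)
qed

text \<open>The eigenvalue equation determines the second derivative almost everywhere as (v -
  \<mu>) u, so the derivative is exactly its indefinite integral. The left boundary condition is
  built into \<open>ivp_solution\<close>; the free constant \<open>c\<close> is the slope at
  -L/2.\<close>

lemma in_eigenspace_iff_ivp_solution:
  assumes v: "v \<in> borel_measurable lebesgue" "\<And>x. \<bar>v x\<bar> \<le> B" and "L > 0"
  shows "u \<in> eigenspace v L \<mu> \<longleftrightarrow>
    (\<exists>c p. ivp_solution (-L/2) (L/2) (\<lambda>x. v x - \<mu>) c u p) \<and> u (L/2) = 0 \<and>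
    (\<forall>x. x \<notin> {-L/2..L/2} \<longrightarrow> u x = 0)"
proof -
  define a b where "a = -L/2" and "b = L/2"
  have ab: "a < b" using \<open>L > 0\<close> by (simp add: a_def b_def)
  define g where "g x = (v x - \<mu>) *\<^sub>R u x" for x
  have q: "(\<lambda>x. v x - \<mu>) \<in> borel_measurable lebesgue" using v(1) by simp
  have qb: "\<bar>v x - \<mu>\<bar> \<le> B + \<bar>\<mu>\<bar>" for x using v(2)[of x] by linarith
  \<comment> \<open>The passage between the Lebesgue integral over an open interval in
    \<open>H2_second_deriv\<close> and the gauge integral over the closed one in
    \<open>ivp_solution\<close>.\<close>
  have g_int: "integrable (lebesgue_on {a<..<x}) g" "integral\<^sup>L (lebesgue_on {a<..<x}) g = integral {a..x} g"
    if "continuous_on {a..b} u" "x \<in> {a..b}" for x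
  proof -
    have "continuous_on {a..x} u" using that by (auto intro: continuous_on_subset)
    then have "g absolutely_integrable_on {a..x}"
      unfolding g_def by (rule absolutely_integrable_scaleR_continuous[OF q qb])
    then have "g absolutely_integrable_on {a<..<x}"
      by (rule set_integrable_subset) auto
    then show "integrable (lebesgue_on {a<..<x}) g"
      by (rule absolutely_integrable_imp_integrable) auto
    then show "integral\<^sup>L (lebesgue_on {a<..<x}) g = integral {a..x} g"
      by (simp add: lebesgue_integral_eq_integral integral_open_interval_real)
  qed
  show ?thesis (is "?l \<longleftrightarrow> ?r")
  proof
    assume ?l
    then have op: "schrodinger_op v L u (\<lambda>x. complex_of_real \<mu> * u x)"
      by (simp add: eigenspace_def)
    then have bc: "u a = 0" "u b = 0" "\<And>x. x \<notin> {a..b} \<Longrightarrow> u x = 0"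
      by (auto simp: schrodinger_op_def dirichlet_domain_def a_def b_def)
    obtain w where H2: "H2_second_deriv L u w"
      and ae: "AE x in lebesgue_on {a<..<b}. complex_of_real \<mu> * u x = - w x + complex_of_real (v x) * u x"
      using op unfolding schrodinger_op_def a_def b_def by blast
    then have w: "L2 L w" by (simp add: H2_second_deriv_def)
    from H2 obtain p where "\<forall>x\<in>{a..b}. (u has_vector_derivative p x) (at x within {a..b}) \<and>
        p x = p a + integral\<^sup>L (lebesgue_on {a<..<x}) w"
      unfolding H2_second_deriv_def a_def b_def by blast
    then have u': "\<And>x. x \<in> {a..b} \<Longrightarrow> (u has_vector_derivative p x) (at x within {a..b})"
      and p: "\<And>x. x \<in> {a..b} \<Longrightarrow> p x = p a + integral\<^sup>L (lebesgue_on {a<..<x}) w"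
      by blast+
    have uc: "continuous_on {a..b} u"
      using u' by (meson continuous_on_vector_derivative)
    have ae_eq: "AE x in lebesgue_on {a<..<b}. w x = g x"
      using ae by eventually_elim (simp add: g_def scaleR_conv_of_real algebra_simps)
    have p_eq: "p x = p a + integral {a..x} g" if x: "x \<in> {a..b}" for x
    proof -
      have sub: "{a<..<x} \<subseteq> {a<..<b}" using x by auto
      have "integral\<^sup>L (lebesgue_on {a<..<x}) w = integral\<^sup>L (lebesgue_on {a<..<x}) g"
      proof (rule integral_cong_AE)
        have "w \<in> borel_measurable (lebesgue_on {a<..<b})" using w by (simp add: L2_def a_def b_def)
        then show "w \<in> borel_measurable (lebesgue_on {a<..<x})"
          by (rule measurable_restrict_mono[OF _ sub])
        show "g \<in> borel_measurable (lebesgue_on {a<..<x})"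
          using g_int(1)[OF uc x] by (rule borel_measurable_integrable)
        show "AE t in lebesgue_on {a<..<x}. w t = g t"
          using ae_eq sub by (auto simp: AE_restrict_space_iff elim!: eventually_mono)
      qed
      then show ?thesis using p[OF x] g_int(2)[OF uc x] by simp
    qed
    have "g integrable_on {a..b}"
      unfolding g_def by (rule integrable_scaleR_continuous[OF q qb uc]) auto
    then have pc: "continuous_on {a..b} p"
      using p_eq by (subst continuous_on_cong[OF refl p_eq])
        (auto intro!: continuous_intros indefinite_integral_continuous_1)
    have "u x = integral {a..x} p" if x: "x \<in> {a..b}" for x
    proof -
      have "(p has_integral (u x - u a)) {a..x}"
        using x by (intro fundamental_theorem_of_calculus)
          (auto intro: has_vector_derivative_within_subset[OF u'])
      then show ?thesis using bc by (simp add: integral_unique)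
    qed
    then have "ivp_solution a b (\<lambda>x. v x - \<mu>) (p a) u p"
      using uc pc p_eq[unfolded g_def] unfolding ivp_solution_def by blast
    then show ?r using bc unfolding a_def b_def by blast
  next
    assume ?r
    then obtain c p where sol: "ivp_solution a b (\<lambda>x. v x - \<mu>) c u p"
      and bc: "u b = 0" "\<And>x. x \<notin> {a..b} \<Longrightarrow> u x = 0"
      unfolding a_def b_def by blast
    have init: "u a = 0" "p a = c" using ivp_solution_initial[OF sol] ab by auto
    have uc: "continuous_on {a..b} u" using sol by (simp add: ivp_solution_def)
    then have "bounded (u ` {a..b})"
      by (intro compact_imp_bounded compact_continuous_image) auto
    then obtain D where D: "\<And>x. x \<in> {a..b} \<Longrightarrow> norm (u x) \<le> D" by (metis bounded_iff imageI)
    have um: "u \<in> borel_measurable (lebesgue_on {a<..<b})"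
      by (intro continuous_imp_measurable_on_sets_lebesgue continuous_on_subset[OF uc]) auto
    have L2g: "L2 L g"
    proof (rule L2_bounded)
      show "g \<in> borel_measurable (lebesgue_on {-L/2<..<L/2})"
        using g_int(1)[OF uc, of b] ab by (auto simp: a_def b_def dest: borel_measurable_integrable)
      show "cmod (g x) \<le> (B + \<bar>\<mu>\<bar>) * D" if "x \<in> {-L/2<..<L/2}" for x
        using qb[of x] D[of x] that
        unfolding g_def norm_scaleR by (intro mult_mono) (auto simp: a_def b_def intro: order_trans[OF abs_ge_zero qb])
    qed
    have L2u: "L2 L (\<lambda>x. complex_of_real \<mu> * u x)"
    proof (rule L2_bounded)
      show "(\<lambda>x. complex_of_real \<mu> * u x) \<in> borel_measurable (lebesgue_on {-L/2<..<L/2})"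
        using um by (simp add: a_def b_def)
      show "cmod (complex_of_real \<mu> * u x) \<le> \<bar>\<mu>\<bar> * D" if "x \<in> {-L/2<..<L/2}" for x
        using D[of x] that by (simp add: norm_mult mult_left_mono a_def b_def)
    qed
    have "(u has_vector_derivative p x) (at x within {a..b}) \<and>
        p x = p a + integral\<^sup>L (lebesgue_on {a<..<x}) g" if x: "x \<in> {a..b}" for x
      using ivp_solution_deriv[OF sol x] g_int(2)[OF uc x] sol x init
      by (auto simp: ivp_solution_def g_def[abs_def])
    then have H2: "H2_second_deriv L u g"
      using L2g unfolding H2_second_deriv_def a_def b_def by blast
    then have "u \<in> dirichlet_domain L"
      using init bc by (auto simp: dirichlet_domain_def a_def b_def)
    moreover have "complex_of_real \<mu> * u x = - g x + complex_of_real (v x) * u x" for x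
      by (simp add: g_def scaleR_conv_of_real algebra_simps)
    ultimately show ?l
      using L2u H2 unfolding eigenspace_def schrodinger_op_def by auto
  qed
qed

lemma ivp_solution_cong:
  assumes sol: "ivp_solution a b q c u p" and eq: "\<And>x. x \<in> {a..b} \<Longrightarrow> u x = u' x"
  shows "ivp_solution a b q c u' p"
proof -
  have "continuous_on {a..b} u'"
    using sol eq continuous_on_cong[of "{a..b}" "{a..b}" u u'] by (simp add: ivp_solution_def)
  moreover have "integral {a..x} (\<lambda>t. q t *\<^sub>R u t) = integral {a..x} (\<lambda>t. q t *\<^sub>R u' t)" if "x \<in> {a..b}" for x
    using that eq by (intro Henstock_Kurzweil_Integration.integral_cong) auto
  ultimately show ?thesis using sol eq by (simp add: ivp_solution_def)
qed

text \<open>Shooting yields a real solution of slope 1, while eigenfunctions are complex with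
  arbitrary slope; complex multiples bridge the two.\<close>

lemma ivp_solution_mult_of_real:
  fixes u p :: "real \<Rightarrow> real"
  assumes sol: "ivp_solution a b q k u p"
    and q: "q \<in> borel_measurable lebesgue" "\<And>t. \<bar>q t\<bar> \<le> K"
  shows "ivp_solution a b q (c * complex_of_real k) (\<lambda>x. c * complex_of_real (u x)) (\<lambda>x. c * complex_of_real (p x))"
proof -
  have cont: "continuous_on {a..b} u" "continuous_on {a..b} p" using sol by (auto simp: ivp_solution_def)
  have int: "integral {a..x} (\<lambda>t. c * complex_of_real (f t)) = c * complex_of_real (integral {a..x} f)"
    if "f integrable_on {a..x}" for f x
    using has_integral_mult_right[OF has_integral_of_real[OF integrable_integral[OF that]]]
    by (rule integral_unique)
  have ip: "p integrable_on {a..x}" if "x \<in> {a..b}" for x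
    using that by (intro integrable_continuous_real continuous_on_subset[OF cont(2)]) auto
  have iq: "(\<lambda>t. q t * u t) integrable_on {a..x}" if "x \<in> {a..b}" for x
    using integrable_scaleR_continuous[OF q cont(1), of a x] that by simp
  have qu: "(\<lambda>t. q t *\<^sub>R (c * complex_of_real (u t))) = (\<lambda>t. c * complex_of_real (q t * u t))"
    by (simp add: scaleR_conv_of_real fun_eq_iff)
  have "u x = integral {a..x} p" "p x = k + integral {a..x} (\<lambda>t. q t * u t)" if "x \<in> {a..b}" for x
    using sol that by (simp_all add: ivp_solution_def)
  then have "c * complex_of_real (u x) = integral {a..x} (\<lambda>t. c * complex_of_real (p t))"
    "c * complex_of_real (p x) = c * complex_of_real k +
      integral {a..x} (\<lambda>t. q t *\<^sub>R (c * complex_of_real (u t)))" if "x \<in> {a..b}" for x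
    unfolding qu using that int[OF ip] int[OF iq] by (metis of_real_add distrib_left)+
  then show ?thesis
    unfolding ivp_solution_def using cont by (intro conjI ballI continuous_intros) auto
qed

text \<open>By uniqueness every eigenfunction is its slope at -L/2 times the zero extension
  \<open>e\<close> of the shooting solution. The condition at L/2 then either holds for all
  multiples or forces the slope to vanish.\<close>

lemma multiplicity_ev_eq:
  assumes v: "v \<in> borel_measurable lebesgue" "\<And>x. \<bar>v x\<bar> \<le> B" and "L > 0"
    and sol: "ivp_solution (-L/2) (L/2) (\<lambda>x. v x - \<mu>) (1::real) u p"
  shows "multiplicity_ev v L \<mu> = (if u (L/2) = 0 then 1 else 0)"
proof -
  interpret fun_space: vector_space fun_scale by (rule vector_space_fun_scale)
  define a b where "a = -L/2" and "b = L/2"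
  have ab: "a < b" using \<open>L > 0\<close> by (simp add: a_def b_def)
  have sol: "ivp_solution a b (\<lambda>x. v x - \<mu>) (1::real) u p" using sol by (simp add: a_def b_def)
  have q: "(\<lambda>x. v x - \<mu>) \<in> borel_measurable lebesgue" using v(1) by simp
  have qb: "\<bar>v x - \<mu>\<bar> \<le> B + \<bar>\<mu>\<bar>" for x using v(2)[of x] by linarith
  define e where "e x = (if x \<in> {a..b} then complex_of_real (u x) else 0)" for x
  note eig = in_eigenspace_iff_ivp_solution[OF v \<open>L > 0\<close>, of _ \<mu>, folded a_def b_def]
  have sole: "ivp_solution a b (\<lambda>x. v x - \<mu>) c (fun_scale c e) (\<lambda>x. c * complex_of_real (p x))" for c
    using ivp_solution_cong[OF ivp_solution_mult_of_real[OF sol q qb, of c], of "fun_scale c e"]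
    by (simp add: e_def fun_scale_def)
  have multiple: "\<exists>c. f = fun_scale c e \<and> c * complex_of_real (u b) = 0" if "f \<in> eigenspace v L \<mu>" for f
  proof -
    obtain c p' where f: "ivp_solution a b (\<lambda>x. v x - \<mu>) c f p'" "f b = 0" "\<And>x. x \<notin> {a..b} \<Longrightarrow> f x = 0"
      using \<open>f \<in> _\<close> eig by auto
    have "f x = fun_scale c e x" for x
      using ivp_solution_unique(1)[OF f(1) sole q qb, of x] f(3)[of x]
      by (cases "x \<in> {a..b}") (auto simp: fun_scale_def e_def)
    then have "f = fun_scale c e" by auto
    moreover from this have "c * complex_of_real (u b) = 0"
      using f(2) ab by (simp add: fun_scale_def e_def)
    ultimately show ?thesis by blast
  qed
  show ?thesis
  proof (cases "u b = 0")
    case True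
    \<comment> \<open>If \<open>u\<close> vanished throughout, \<open>p\<close> would be constantly
      1 and \<open>u b\<close> would equal \<open>b - a\<close>, which is positive.\<close>
    have "e \<noteq> 0"
    proof
      assume "e = 0"
      then have u0: "u x = 0" if "x \<in> {a..b}" for x
        using that by (auto simp: e_def fun_eq_iff split: if_splits)
      have "p x = 1" if x: "x \<in> {a..b}" for x
      proof -
        have "integral {a..x} (\<lambda>t. (v t - \<mu>) * u t) = integral {a..x} (\<lambda>t. 0)"
          using x u0 by (intro Henstock_Kurzweil_Integration.integral_cong) auto
        then show ?thesis using sol x by (simp add: ivp_solution_def)
      qed
      then have "integral {a..b} p = integral {a..b} (\<lambda>_. 1)"
        by (intro Henstock_Kurzweil_Integration.integral_cong) auto
      then show False using sol u0[of b] ab by (auto simp: ivp_solution_def)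
    qed
    then have "fun_space.independent {e}" by simp
    moreover have "e \<in> eigenspace v L \<mu>"
    proof -
      have "fun_scale 1 e = e" by (simp add: fun_scale_def)
      then show ?thesis using sole[of 1] True ab unfolding eig by (auto simp: e_def)
    qed
    moreover have "eigenspace v L \<mu> \<subseteq> fun_space.span {e}"
      using multiple by (auto intro: fun_space.span_scale fun_space.span_base)
    ultimately have "fun_space.dim (eigenspace v L \<mu>) = 1"
      by (intro fun_space.dim_unique[of "{e}"]) auto
    then show ?thesis using True by (simp add: multiplicity_ev_def b_def)
  next
    case False
    then have "eigenspace v L \<mu> \<subseteq> fun_space.span {}"
      using multiple by (auto simp: fun_space.span_empty)
    then have "fun_space.dim (eigenspace v L \<mu>) = 0"
      by (intro fun_space.dim_unique[of "{}"]) (auto simp: fun_space.independent_empty)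
    then show ?thesis using False by (simp add: multiplicity_ev_def b_def)
  qed
qed

section \<open>Positivity of the eigenvalues and the bound on the gap\<close>

lemma multiplicity_ev_pos_imp_pos:
  assumes v: "v \<in> borel_measurable lebesgue" "\<And>x. 0 \<le> v x" "\<And>x. v x \<le> B" and "L > 0"
    and "multiplicity_ev v L \<mu> > 0"
  shows "\<mu> > 0"
proof (rule ccontr)
  assume "\<not> \<mu> > 0"
  have q: "(\<lambda>x. v x - \<mu>) \<in> borel_measurable lebesgue" using v(1) by simp
  have qb: "\<bar>v x - \<mu>\<bar> \<le> B + \<bar>\<mu>\<bar>" for x using v(2)[of x] v(3)[of x] by linarith
  obtain u p where sol: "ivp_solution (-L/2) (L/2) (\<lambda>x. v x - \<mu>) (1::real) u p"
    using ivp_solution_exists[OF q qb, of "-L/2" "L/2"] \<open>L > 0\<close> by auto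
  \<comment> \<open>For \<mu> \<le> 0 the coefficient is nonnegative, so the shooting solution is at
    least L at the right endpoint and the Dirichlet condition fails.\<close>
  have "0 \<le> v x - \<mu>" for x using v(2)[of x] \<open>\<not> \<mu> > 0\<close> by linarith
  from ivp_solution_ge[OF sol q qb this, of "L/2"] have "u (L/2) \<ge> L" using \<open>L > 0\<close> by simp
  moreover have vb: "\<bar>v x\<bar> \<le> B" for x using v(2)[of x] v(3)[of x] by simp
  ultimately have "multiplicity_ev v L \<mu> = 0"
    using multiplicity_ev_eq[OF v(1) vb \<open>L > 0\<close> sol] \<open>L > 0\<close> by simp
  then show False using assms by simp
qed

lemma spectral_gap_le:
  fixes v :: "real \<Rightarrow> real"
  assumes v: "v \<in> borel_measurable lebesgue" "\<And>x. 0 \<le> v x" "\<And>x. v x \<le> B"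
    and decay: "\<And>x. v x \<le> C / x\<^sup>2" and "C > 0" "L > 0"
  shows "spectral_gap v L \<le> (64 * C + 1024) / L\<^sup>2"
proof -
  \<comment> \<open>For x \<ge> L/8 the decay gives \<open>v x \<le> 64 * C / L\<^sup>2\<close>. The
    two intervals used below have length L/8, so oscillation on them needs
    \<open>\<kappa> = 16 / (L/8)\<^sup>2 = 1024 / L\<^sup>2\<close>; \<open>M\<close> is the
    sum.\<close>
  define M where "M = (64 * C + 1024) / L\<^sup>2"
  have vb: "\<bar>v x\<bar> \<le> B" for x using v(2)[of x] v(3)[of x] by simp
  have le: "v x \<le> M - 1024 / L\<^sup>2" if "x \<ge> L / 8" for x
  proof -
    have "(L / 8)\<^sup>2 \<le> x\<^sup>2" using that \<open>L > 0\<close> by (intro power_mono) auto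
    then have "C / x\<^sup>2 \<le> C / (L / 8)\<^sup>2"
      using \<open>C > 0\<close> \<open>L > 0\<close> by (intro divide_left_mono mult_pos_pos) (auto intro!: zero_less_power)
    also have "\<dots> = M - 1024 / L\<^sup>2" by (simp add: M_def power_divide add_divide_distrib)
    finally show ?thesis using decay[of x] by linarith
  qed
  have "\<exists>\<mu>1 \<mu>2. \<mu>1 \<noteq> \<mu>2 \<and> (\<forall>\<mu>\<in>{\<mu>1, \<mu>2}. \<mu> \<le> M \<and>
      (\<exists>u p. ivp_solution (-L/2) (L/2) (\<lambda>x. v x - \<mu>) (1::real) u p \<and> u (L/2) = 0))"
    by (rule two_dirichlet_solutions[OF v, where c="L/8" and d="L/4" and c'="3*L/8" and d'="L/2" and \<kappa>="1024/L\<^sup>2"])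
      (use \<open>L > 0\<close> \<open>C > 0\<close> le in \<open>auto simp: M_def field_simps power2_eq_square add_pos_pos\<close>)
  then obtain \<mu>1 \<mu>2 where \<mu>: "\<mu>1 \<noteq> \<mu>2" "\<mu>1 \<le> M" "\<mu>2 \<le> M" "multiplicity_ev v L \<mu>1 = 1" "multiplicity_ev v L \<mu>2 = 1"
    using multiplicity_ev_eq[OF v(1) vb \<open>L > 0\<close>] by auto
  then have M2: "at_least_eigenvalues_le v L 2 M"
    unfolding at_least_eigenvalues_le_def by (intro exI[of _ "{\<mu>1, \<mu>2}"]) auto
  have nonneg: "E \<ge> 0" if "at_least_eigenvalues_le v L (Suc n) E" for n E
  proof -
    obtain F where F: "finite F" "F \<subseteq> {..E}" "Suc n \<le> (\<Sum>\<mu>\<in>F. multiplicity_ev v L \<mu>)"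
      using \<open>at_least_eigenvalues_le v L (Suc n) E\<close> by (auto simp: at_least_eigenvalues_le_def)
    then obtain \<mu> where "\<mu> \<in> F" "multiplicity_ev v L \<mu> \<noteq> 0"
      by (metis not_less_eq_eq sum.neutral zero_le)
    then show ?thesis
      using multiplicity_ev_pos_imp_pos[OF v \<open>L > 0\<close>, of \<mu>] F(2) by fastforce
  qed
  \<comment> \<open>A real \<open>Inf\<close> is informative only for a nonempty set that is bounded
    below. Numbering from 0, \<open>eigenvalue v L 1\<close> asks for two eigenvalues, so
    \<open>M\<close> belongs to its set; \<open>M\<close> also makes the set for
    \<open>eigenvalue v L 0\<close> nonempty, and 0 is a lower bound of both.\<close>
  have "bdd_below {E. at_least_eigenvalues_le v L (Suc 1) E}"
    using nonneg by (intro bdd_belowI[of _ 0]) auto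
  then have "eigenvalue v L 1 \<le> M"
    unfolding eigenvalue_def using M2 by (intro cInf_lower) (auto simp: numeral_2_eq_2)
  moreover have "at_least_eigenvalues_le v L (Suc 0) M"
    using M2 by (fastforce simp: at_least_eigenvalues_le_def)
  then have "eigenvalue v L 0 \<ge> 0"
    unfolding eigenvalue_def using nonneg by (intro cInf_greatest) auto
  ultimately show ?thesis by (simp add: spectral_gap_def M_def)
qed

theorem theorem2p1:
  fixes v :: "real \<Rightarrow> real" and C :: real
  assumes "Linfty v"
    and "AE x in lebesgue. 0 \<le> v x"
    and "C > 0"
    and "AE x in lebesgue. \<bar>v x\<bar> \<le> C / \<bar>x\<bar>\<^sup>2"
  shows "\<exists>\<beta>. \<forall>\<^sub>F L in at_top. spectral_gap v L \<le> \<beta> / L\<^sup>2"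
proof -
  obtain B where B: "AE x in lebesgue. \<bar>v x\<bar> \<le> B" and meas: "v \<in> borel_measurable lebesgue"
    using assms(1) by (auto simp: Linfty_def)
  \<comment> \<open>Clamping makes the three almost-everywhere bounds hold at every point. At the
    origin \<open>C / x\<^sup>2\<close> evaluates to 0, so \<open>w 0 = 0\<close> and the decay
    bound holds there too; \<open>\<bar>B\<bar>\<close> is nonnegative by form, so the outer
    \<open>max\<close> cannot break the upper bound.\<close>
  define w where "w x = max 0 (min (v x) (min \<bar>B\<bar> (C / x\<^sup>2)))" for x
  have "AE x in lebesgue. v x = w x"
    using assms(2,4) B by eventually_elim (auto simp: w_def)
  then have "spectral_gap v L = spectral_gap w L" for L by (rule spectral_gap_cong_AE)
  moreover have "spectral_gap w L \<le> (64 * C + 1024) / L\<^sup>2" if "L > 0" for L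
  proof (rule spectral_gap_le[where B="\<bar>B\<bar>"])
    have "(\<lambda>x. C / x\<^sup>2) \<in> borel_measurable lebesgue"
      by (rule measurable_completion) measurable
    then show "w \<in> borel_measurable lebesgue"
      unfolding w_def using meas by measurable
    show "w x \<le> C / x\<^sup>2" for x using \<open>C > 0\<close> by (simp add: w_def)
  qed (use that \<open>C > 0\<close> in \<open>auto simp: w_def\<close>)
  ultimately show ?thesis
    by (intro exI[of _ "64 * C + 1024"] eventually_mono[OF eventually_gt_at_top[of 0]]) simp
qed

end
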